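(* Suppose that $p \in \Sigma_{3,6}$ lies on the boundary of the cone $\Sigma_{3,6}$ (as a subset of $H_{3,6}$) and $p$ is a strictly positive form, i.e. $p(x)>0$ for all nonzero $x\in\mathbb{R}^3$. Then $p$ is a sum of $3$ squares of forms in $H_{3,3}$ and cannot be written as a sum of $2$ squares of forms in $H_{3,3}$.
   Context: $H_{n,d}$ is the real vector space of real forms (homogeneous polynomials) of degree $d$ in $n$ variables. $\Sigma_{n,2d}=\{p\in H_{n,2d} : p=\sum_i q_i^2 \text{ (finite sum) for some } q_i\in H_{n,d}\}$; it is a full-dimensional closed convex cone in $H_{n,2d}$. *)

theory Defs
  imports "HOL-Analysis.Analysis" "HOL-Library.Poly_Mapping"
begin

text \<open>
  Real polynomials in the variables indexed by \<open>'n\<close>: finitely supported coefficient functions on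
  exponent vectors, with the convolution ring structure of \<open>Poly_Mapping\<close>. The number of
  variables is \<open>CARD('n)\<close>.
\<close>

type_synonym 'n real_mpoly = "('n \<Rightarrow>\<^sub>0 nat) \<Rightarrow>\<^sub>0 real"

definition mpoly_eval :: "'n::finite real_mpoly \<Rightarrow> real ^ 'n \<Rightarrow> real" where
  "mpoly_eval p x =
    (\<Sum>m\<in>Poly_Mapping.keys p. Poly_Mapping.lookup p m * (\<Prod>i\<in>UNIV. (x $ i) ^ Poly_Mapping.lookup m i))"

text \<open>The space $H_{n,d}$; it contains the zero polynomial.\<close>

definition forms :: "nat \<Rightarrow> 'n::finite real_mpoly set" where
  "forms d = {p. \<forall>m\<in>Poly_Mapping.keys p. (\<Sum>i\<in>UNIV. Poly_Mapping.lookup m i) = d}"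

text \<open>
  The topology of coefficientwise convergence on $H_{n,d}$. Only the finitely many coefficients at
  exponent vectors of total degree \<open>d\<close> can be nonzero, so this is the usual topology of a
  finite-dimensional real vector space.
\<close>

definition forms_topology :: "nat \<Rightarrow> 'n::finite real_mpoly topology" where
  "forms_topology d = pullback_topology (forms d) Poly_Mapping.lookup euclidean"

text \<open>Some of the forms \<open>q i\<close> may be zero, so this says that at most \<open>k\<close> squares are needed.\<close>

definition sum_of_form_squares :: "nat \<Rightarrow> nat \<Rightarrow> 'n::finite real_mpoly \<Rightarrow> bool" where
  "sum_of_form_squares k d p \<longleftrightarrow>
    (\<exists>q. (\<forall>i<k. q i \<in> forms d) \<and> p = (\<Sum>i<k. (q i)\<^sup>2))"

text \<open>The cone $\Sigma_{n,2d}$; the argument is the degree \<open>d\<close> of the forms that are squared.\<close>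

definition sos_cone :: "nat \<Rightarrow> 'n::finite real_mpoly set" where
  "sos_cone d = {p \<in> forms (2 * d). \<exists>k. sum_of_form_squares k d p}"

end

theory Submission
  imports Defs
begin

text \<open>
  Separating a boundary point \<open>p\<close> from the cone gives a nonzero functional \<open>L\<close> on sextics with
  \<open>L (f\<^sup>2) \<ge> 0\<close> and \<open>L p = 0\<close>, so every cubic occurring in a representation of \<open>p\<close> as a sum of
  squares lies in the kernel \<open>W\<close> of the form \<open>(f, h) \<mapsto> L (f h)\<close>. A representation of minimal length
  consists of linearly independent cubics, so it suffices that \<open>W\<close> has a common real zero as soon as
  \<open>dim W \<ge> 4\<close>: this zero would be a zero of \<open>p\<close>.

  Suppose first that for some linear form \<open>l\<close> no product \<open>l g\<close> with \<open>g \<noteq> 0\<close> quadratic lies in \<open>W\<close>.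
  By dimension, cubics modulo \<open>W\<close> are the multiples of \<open>l\<close>, and multiplication by \<open>m/l\<close> and \<open>n/l\<close>,
  for linear forms \<open>m, n\<close>, are commuting operators that are symmetric for the form. A common
  eigenvector yields a functional that vanishes on \<open>W\<close> and is a multiple of a point evaluation.
  Otherwise, if \<open>(l + t m) g\<^sub>t \<in> W\<close> for all \<open>t\<close>, then the \<open>m g\<^sub>t\<close> are pairwise orthogonal, so almost all of
  them are in \<open>W\<close>; hence \<open>W\<close> contains all linear multiples of some quadratic form \<open>g \<noteq> 0\<close>. Diagonalizing
  \<open>g\<close>, either \<open>W\<close> contains all multiples of a linear form, or \<open>g = X Z + c Y\<^sup>2\<close>; then multiplication by
  the rational function \<open>- Z/Y\<close> on the conic \<open>g = 0\<close>, which has a pole at a real point of the conic, is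
  again symmetric, and an eigenvector gives the common zero.

  Two real ternary cubics are odd maps and have a common zero on the sphere by the Borsuk-Ulam
  argument, so two squares do not suffice.
\<close>

subsection \<open>Forms\<close>

text \<open>Scalar multiplication of polynomials is written \<open>const_poly c * p\<close>, so that
  linear combinations and products obey the same ring laws.\<close>

definition const_poly :: "real \<Rightarrow> 'n real_mpoly" where
  "const_poly c = Poly_Mapping.single 0 c"

definition poly_var :: "'n \<Rightarrow> 'n real_mpoly" where
  "poly_var i = Poly_Mapping.single (Poly_Mapping.single i 1) 1"

definition mono_degree :: "('n::finite \<Rightarrow>\<^sub>0 nat) \<Rightarrow> nat" where
  "mono_degree m = (\<Sum>i\<in>UNIV. Poly_Mapping.lookup m i)"

lemma mono_degree_add: "mono_degree (m + m') = mono_degree m + mono_degree m'"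
  by (simp add: mono_degree_def lookup_add sum.distrib)

lemma mono_degree_zero [simp]: "mono_degree 0 = 0"
  by (simp add: mono_degree_def)

lemma mono_degree_single [simp]: "mono_degree (Poly_Mapping.single i k) = k"
  by (simp add: mono_degree_def lookup_single when_def)

lemma forms_iff: "p \<in> forms d \<longleftrightarrow> (\<forall>m. Poly_Mapping.lookup p m \<noteq> 0 \<longrightarrow> mono_degree m = d)"
  by (auto simp: forms_def mono_degree_def in_keys_iff)

lemma forms_0 [simp, intro]: "0 \<in> forms d"
  by (simp add: forms_def)

lemma forms_add [intro]: "p \<in> forms d \<Longrightarrow> q \<in> forms d \<Longrightarrow> p + q \<in> forms d"
  unfolding forms_iff lookup_add by (metis add.right_neutral)

lemma forms_uminus [intro]: "p \<in> forms d \<Longrightarrow> - p \<in> forms d"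
  by (simp add: forms_iff)

lemma forms_diff [intro]: "p \<in> forms d \<Longrightarrow> q \<in> forms d \<Longrightarrow> p - q \<in> forms d"
  using forms_add[of p d "- q"] forms_uminus[of q d] by simp

lemma forms_sum [intro]: "(\<And>i. i \<in> I \<Longrightarrow> f i \<in> forms d) \<Longrightarrow> sum f I \<in> forms d"
  by (induction I rule: infinite_finite_induct) auto

lemma forms_mult:
  assumes "p \<in> forms a" "q \<in> forms b"
  shows "p * q \<in> forms (a + b)"
  unfolding forms_def
proof (clarsimp)
  fix m assume "m \<in> Poly_Mapping.keys (p * q)"
  with keys_mult obtain s t where "m = s + t" "s \<in> Poly_Mapping.keys p" "t \<in> Poly_Mapping.keys q"
    by blast
  with assms show "(\<Sum>i\<in>UNIV. Poly_Mapping.lookup m i) = a + b"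
    by (auto simp: forms_def lookup_add sum.distrib)
qed

lemma forms_mult': "p \<in> forms a \<Longrightarrow> q \<in> forms b \<Longrightarrow> c = a + b \<Longrightarrow> p * q \<in> forms c"
  by (simp add: forms_mult)

lemma forms_single: "mono_degree m = d \<Longrightarrow> Poly_Mapping.single m c \<in> forms d"
  by (simp add: forms_iff lookup_single when_def)

lemma const_poly_forms [simp, intro]: "const_poly c \<in> forms 0"
  by (simp add: const_poly_def forms_single)

lemma const_poly_mult_forms [intro]: "p \<in> forms d \<Longrightarrow> const_poly c * p \<in> forms d"
  using forms_mult[OF const_poly_forms] by fastforce

lemma poly_var_forms [simp, intro]: "poly_var i \<in> forms (Suc 0)"
  by (simp add: poly_var_def forms_single)

lemma const_poly_mult: "const_poly (a * b) = const_poly a * const_poly b"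
  by (simp add: const_poly_def mult_single)

lemma const_poly_add: "const_poly (a + b) = const_poly a + const_poly b"
  by (simp add: const_poly_def single_add)

lemma const_poly_uminus: "const_poly (- a) = - const_poly a"
  by (simp add: const_poly_def single_uminus)

lemma const_poly_diff: "const_poly (a - b) = const_poly a - const_poly b"
  by (simp add: const_poly_def single_diff)

lemma const_poly_0 [simp]: "const_poly 0 = 0"
  by (simp add: const_poly_def)

lemma const_poly_1 [simp]: "const_poly 1 = 1"
  by (simp add: const_poly_def)

lemma lookup_const_poly_mult [simp]:
  "Poly_Mapping.lookup (const_poly c * p) m = c * Poly_Mapping.lookup p m"
  by (simp flip: mult_map_scale_conv_mult add: const_poly_def map.rep_eq when_def)

lemma poly_eq_sum_monomials:
  "p = (\<Sum>m\<in>Poly_Mapping.keys p. Poly_Mapping.single m (Poly_Mapping.lookup p m))"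
  by (rule poly_mapping_eqI) (auto simp: lookup_sum lookup_single when_def sum.delta in_keys_iff)

lemma mono_degree_pos_split:
  assumes "mono_degree m = Suc d"
  obtains i m' where "m = Poly_Mapping.single i 1 + m'" "mono_degree m' = d"
proof -
  from assms obtain i where i: "Poly_Mapping.lookup m i \<noteq> 0"
    unfolding mono_degree_def by (metis nat.distinct(1) sum.neutral)
  define m' where "m' = m - Poly_Mapping.single i 1"
  have m: "m = Poly_Mapping.single i 1 + m'"
    using i by (intro poly_mapping_eqI) (auto simp: m'_def lookup_add lookup_minus lookup_single when_def)
  with assms have "mono_degree m' = d" by (simp add: mono_degree_add)
  with m that show ?thesis by blast
qed

text \<open>A monomial of positive degree contains a variable, and the decompositions of single
  monomials add up. This is the step for inductions on the degree of a form.\<close>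

lemma forms_Suc_decompose:
  fixes p :: "'n::finite real_mpoly"
  assumes "p \<in> forms (Suc d)"
  obtains r where "\<And>i. r i \<in> forms d" "p = (\<Sum>i\<in>UNIV. poly_var i * r i)"
proof -
  define P where "P p \<longleftrightarrow> (\<exists>r. (\<forall>i. r i \<in> forms d) \<and> p = (\<Sum>i\<in>UNIV. poly_var i * r i))"
    for p :: "'n real_mpoly"
  have P0: "P 0" unfolding P_def by (rule exI[of _ "\<lambda>_. 0"]) simp
  have Padd: "P (p + q)" if "P p" "P q" for p q
  proof -
    from that obtain r s where "\<forall>i. r i \<in> forms d" "p = (\<Sum>i\<in>UNIV. poly_var i * r i)"
      "\<forall>i. s i \<in> forms d" "q = (\<Sum>i\<in>UNIV. poly_var i * s i)" unfolding P_def by blast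
    then show ?thesis unfolding P_def
      by (intro exI[of _ "\<lambda>i. r i + s i"]) (auto simp: distrib_left sum.distrib)
  qed
  have Psum: "P (sum f I)" if "\<And>i. i \<in> I \<Longrightarrow> P (f i)" for f and I :: "('n \<Rightarrow>\<^sub>0 nat) set"
    using that by (induction I rule: infinite_finite_induct) (auto simp: P0 Padd)
  have "P p"
  proof (subst poly_eq_sum_monomials, rule Psum)
    fix m assume "m \<in> Poly_Mapping.keys p"
    with assms have "mono_degree m = Suc d" by (auto simp: forms_iff in_keys_iff)
    then obtain j m' where m: "m = Poly_Mapping.single j 1 + m'" "mono_degree m' = d"
      by (rule mono_degree_pos_split)
    let ?c = "Poly_Mapping.lookup p m"
    have "Poly_Mapping.single m ?c = poly_var j * Poly_Mapping.single m' ?c"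
      by (simp add: poly_var_def mult_single m)
    also have "\<dots> = (\<Sum>i\<in>UNIV. poly_var i * (if i = j then Poly_Mapping.single m' ?c else 0))"
      by (simp add: if_distrib cong: if_cong)
    finally show "P (Poly_Mapping.single m ?c)"
      unfolding P_def using m(2)
      by (intro exI[of _ "\<lambda>i. if i = j then Poly_Mapping.single m' ?c else 0"]) (auto simp: forms_single)
  qed
  with that show ?thesis unfolding P_def by blast
qed

lemma forms_0_const: "p \<in> forms 0 \<Longrightarrow> p = const_poly (Poly_Mapping.lookup p 0)"
proof (rule poly_mapping_eqI)
  fix m :: "'a \<Rightarrow>\<^sub>0 nat" assume p: "p \<in> forms 0"
  have "m = 0" if "mono_degree m = 0"
    using that by (intro poly_mapping_eqI) (simp add: mono_degree_def)
  with p show "Poly_Mapping.lookup p m = Poly_Mapping.lookup (const_poly (Poly_Mapping.lookup p 0)) m"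
    by (auto simp: const_poly_def forms_iff lookup_single when_def)
qed

subsection \<open>Evaluation\<close>

lemma mpoly_eval_superset:
  assumes "finite A" "Poly_Mapping.keys p \<subseteq> A"
  shows "mpoly_eval p x = (\<Sum>m\<in>A. Poly_Mapping.lookup p m * (\<Prod>i\<in>UNIV. (x $ i) ^ Poly_Mapping.lookup m i))"
  unfolding mpoly_eval_def using assms
  by (intro sum.mono_neutral_left) (auto simp: in_keys_iff)

lemma mpoly_eval_add: "mpoly_eval (p + q) x = mpoly_eval p x + mpoly_eval q x"
proof -
  let ?A = "Poly_Mapping.keys p \<union> Poly_Mapping.keys q"
  show ?thesis
    using keys_add[of p q]
    by (simp add: mpoly_eval_superset[of ?A] lookup_add distrib_right sum.distrib)
qed

lemma mpoly_eval_0 [simp]: "mpoly_eval 0 x = 0"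
  by (simp add: mpoly_eval_def)

lemma mpoly_eval_sum: "mpoly_eval (sum f I) x = (\<Sum>i\<in>I. mpoly_eval (f i) x)"
  by (induction I rule: infinite_finite_induct) (auto simp: mpoly_eval_add)

lemma mpoly_eval_single:
  "mpoly_eval (Poly_Mapping.single m c) x = c * (\<Prod>i\<in>UNIV. (x $ i) ^ Poly_Mapping.lookup m i)"
  by (simp add: mpoly_eval_superset[of "{m}"])

lemma mpoly_eval_const [simp]: "mpoly_eval (const_poly c) x = c"
  by (simp add: const_poly_def mpoly_eval_single)

lemma mpoly_eval_mult: "mpoly_eval (p * q) x = mpoly_eval p x * mpoly_eval q x"
proof -
  let ?s = "\<lambda>p m. Poly_Mapping.single m (Poly_Mapping.lookup p m)"
  have "mpoly_eval (p * q) x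
      = mpoly_eval ((\<Sum>m\<in>Poly_Mapping.keys p. ?s p m) * (\<Sum>m\<in>Poly_Mapping.keys q. ?s q m)) x"
    by (simp flip: poly_eq_sum_monomials)
  also have "\<dots> = (\<Sum>m\<in>Poly_Mapping.keys p. mpoly_eval (?s p m) x) * (\<Sum>m\<in>Poly_Mapping.keys q. mpoly_eval (?s q m) x)"
    by (simp add: sum_product mpoly_eval_sum mult_single mpoly_eval_single lookup_add power_add
          prod.distrib mult_ac)
  also have "\<dots> = mpoly_eval p x * mpoly_eval q x"
    by (simp flip: mpoly_eval_sum poly_eq_sum_monomials)
  finally show ?thesis .
qed

lemma mpoly_eval_var [simp]: "mpoly_eval (poly_var i) x = x $ i"
proof -
  have "(\<Prod>j\<in>UNIV. (x $ j) ^ Poly_Mapping.lookup (Poly_Mapping.single i (1::nat)) j)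
      = (\<Prod>j\<in>UNIV. if j = i then x $ j else 1)"
    by (intro prod.cong) (auto simp: lookup_single when_def)
  then show ?thesis by (simp add: poly_var_def mpoly_eval_single)
qed

lemma mpoly_eval_power2: "mpoly_eval (p\<^sup>2) x = (mpoly_eval p x)\<^sup>2"
  by (simp add: power2_eq_square mpoly_eval_mult)

lemma continuous_on_mpoly_eval: "continuous_on S (mpoly_eval p)"
  unfolding mpoly_eval_def by (intro continuous_intros)

lemma mpoly_eval_uminus_arg:
  assumes "p \<in> forms d"
  shows "mpoly_eval p (- x) = (-1) ^ d * mpoly_eval p x"
proof -
  have "(\<Prod>i\<in>UNIV. ((- x) $ i) ^ Poly_Mapping.lookup m i)
      = (-1) ^ d * (\<Prod>i\<in>UNIV. (x $ i) ^ Poly_Mapping.lookup m i)"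
    if "m \<in> Poly_Mapping.keys p" for m
  proof -
    have "(\<Prod>i\<in>UNIV. ((- x) $ i) ^ Poly_Mapping.lookup m i)
        = (\<Prod>i\<in>UNIV. (-1) ^ Poly_Mapping.lookup m i * (x $ i) ^ Poly_Mapping.lookup m i)"
      by (simp flip: power_mult_distrib)
    also have "\<dots> = (-1) ^ (\<Sum>i\<in>UNIV. Poly_Mapping.lookup m i) * (\<Prod>i\<in>UNIV. (x $ i) ^ Poly_Mapping.lookup m i)"
      by (simp add: prod.distrib power_sum)
    finally show ?thesis using assms that by (simp add: forms_def)
  qed
  then show ?thesis by (simp add: mpoly_eval_def sum_distrib_left mult_ac)
qed

lemma mpoly_eval_form_0: "p \<in> forms (Suc d) \<Longrightarrow> mpoly_eval p 0 = 0"
  by (auto elim!: forms_Suc_decompose simp: mpoly_eval_sum mpoly_eval_mult)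

subsection \<open>Generalized eigenvectors of symmetric bilinear forms\<close>

lemma quadratic_nonneg_imp_linear_zero:
  fixes c d :: real
  assumes "\<And>t. 0 \<le> 2 * t * c + t\<^sup>2 * d"
  shows "c = 0"
proof (rule ccontr)
  assume "c \<noteq> 0"
  \<comment> \<open>At \<open>t = - c / k\<close> with \<open>k > 0\<close> and
    \<open>d \<le> k\<close>, the linear term beats the quadratic one: the value is at most
    \<open>- (c\<^sup>2 / k)\<close>.\<close>
  define k where "k = \<bar>d\<bar> + 1"
  have k: "k > 0" "d \<le> k" by (auto simp: k_def)
  have "0 \<le> 2 * (- c / k) * c + (- c / k)\<^sup>2 * d" by (rule assms)
  also have "\<dots> \<le> 2 * (- c / k) * c + (- c / k)\<^sup>2 * k"
    using k by (intro add_left_mono mult_left_mono) auto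
  also have "\<dots> = - (c\<^sup>2 / k)" using k by (simp add: power2_eq_square field_simps)
  also have "\<dots> < 0" using k \<open>c \<noteq> 0\<close> by simp
  finally show False by simp
qed

text \<open>Cauchy-Schwarz in the degenerate case: \<open>Q\<close> at \<open>u + t v\<close> has no
  constant term in \<open>t\<close>, so nonnegativity for all \<open>t\<close> kills the linear
  coefficient.\<close>

lemma psd_null_vector:
  assumes Q: "bilinear Q" and sym: "\<And>u v. Q u v = (Q v u :: real)"
    and S: "subspace S" and nonneg: "\<And>u. u \<in> S \<Longrightarrow> 0 \<le> Q u u"
    and u: "u \<in> S" "Q u u = 0" and v: "v \<in> S"
  shows "Q u v = 0"
proof (rule quadratic_nonneg_imp_linear_zero)
  fix t :: real
  have "0 \<le> Q (u + t *\<^sub>R v) (u + t *\<^sub>R v)"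
    by (intro nonneg subspace_add subspace_scale S u v)
  also have "\<dots> = 2 * t * Q u v + t\<^sup>2 * Q v v"
    using u(2) sym[of v u]
    by (simp add: bilinear_ladd[OF Q] bilinear_radd[OF Q] bilinear_lmul[OF Q] bilinear_rmul[OF Q]
        power2_eq_square algebra_simps)
  finally show "0 \<le> 2 * t * Q u v + t\<^sup>2 * Q v v" .
qed

text \<open>The eigenvector maximizes the Rayleigh quotient \<open>B / Q\<close>. Since
  \<open>Q\<close> may be degenerate on \<open>S\<close>, \<open>ker\<close> lets \<open>B\<close>
  vanish on the null vectors of \<open>Q\<close>, so that both forms live on the quotient by these
  vectors.\<close>

lemma generalized_eigenvector_max:
  fixes B Q :: "'a::euclidean_space \<Rightarrow> 'a \<Rightarrow> real"
  assumes B: "bilinear B" and Bsym: "\<And>u v. B u v = B v u"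
    and Q: "bilinear Q" and Qsym: "\<And>u v. Q u v = Q v u"
    and S: "subspace S" and nonneg: "\<And>u. u \<in> S \<Longrightarrow> 0 \<le> Q u u"
    and ker: "\<And>u v. u \<in> S \<Longrightarrow> v \<in> S \<Longrightarrow> Q u u = 0 \<Longrightarrow> B u v = 0"
    and ex: "\<exists>u\<in>S. Q u u \<noteq> 0"
  shows "\<exists>a. \<exists>u\<in>S. Q u u \<noteq> 0 \<and> (\<forall>v\<in>S. B u v = a * Q u v \<and> B v v \<le> a * Q v v)"
proof -
  note bil = bilinear_ladd[OF B] bilinear_radd[OF B] bilinear_lmul[OF B] bilinear_rmul[OF B]
    bilinear_ladd[OF Q] bilinear_radd[OF Q] bilinear_lmul[OF Q] bilinear_rmul[OF Q]
  note Qnull = psd_null_vector[OF Q Qsym S nonneg]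
  define Z where "Z = {u \<in> S. Q u u = 0}"
  have Z: "subspace Z"
    using Qnull S unfolding Z_def subspace_def
    by (auto simp: bil bilinear_lzero[OF Q] Qsym)
  \<comment> \<open>The Euclidean complement \<open>T\<close> of \<open>Z\<close> in
    \<open>S\<close> models the quotient \<open>S / Z\<close>. There \<open>Q\<close> is positive
    definite, so \<open>B / Q\<close> is continuous on the compact unit sphere \<open>C\<close> of
    \<open>T\<close>.\<close>
  define T where "T = S \<inter> {y. \<forall>z\<in>Z. orthogonal z y}"
  have T: "subspace T" unfolding T_def
    by (intro subspace_inter S subspace_orthogonal_to_vectors)
  have split: "\<exists>z\<in>Z. \<exists>w\<in>T. v = z + w" if v: "v \<in> S" for v
  proof -
    obtain z w where "z \<in> span Z" "\<And>x. x \<in> span Z \<Longrightarrow> orthogonal w x" "v = z + w"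
      using orthogonal_subspace_decomp_exists by blast
    moreover have "w \<in> S"
      using calculation v S Z subspace_diff[OF S, of v z] by (auto simp: span_eq_iff[THEN iffD2] Z_def)
    ultimately have "z \<in> Z" "w \<in> T"
      using Z by (auto simp: T_def span_eq_iff[THEN iffD2] orthogonal_commute)
    with \<open>v = z + w\<close> show ?thesis by blast
  qed
  have Bsplit: "B v v = B w w" "Q v v = Q w w" if "z \<in> Z" "w \<in> T" "v = z + w" for v w z
  proof -
    have "z \<in> S" "Q z z = 0" "w \<in> S" using that by (auto simp: Z_def T_def)
    with ker[of z] Qnull[of z] that(3) Bsym[of w z] Qsym[of w z]
    show "B v v = B w w" "Q v v = Q w w" by (simp_all add: bil)
  qed
  have Tpos: "Q w w > 0" if "w \<in> T" "w \<noteq> 0" for w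
  proof -
    have "w \<in> S" using that by (simp add: T_def)
    moreover have "w \<notin> Z" using that by (auto simp: T_def orthogonal_def)
    ultimately show ?thesis using nonneg[of w] by (auto simp: Z_def less_le)
  qed
  define C where "C = T \<inter> sphere 0 1"
  have "compact C" unfolding C_def
    by (intro closed_Int_compact closed_subspace T compact_sphere)
  moreover have "C \<noteq> {}"
  proof -
    obtain v where v: "v \<in> S" "Q v v \<noteq> 0" using ex by blast
    then obtain z w where zw: "z \<in> Z" "w \<in> T" "v = z + w" using split by blast
    have "w \<noteq> 0" using v Bsplit(2)[OF zw] by (auto simp: bilinear_lzero[OF Q])
    then have "(1 / norm w) *\<^sub>R w \<in> C" using zw T by (simp add: C_def subspace_scale)
    then show ?thesis by blast
  qed
  moreover have "continuous_on C (\<lambda>w. B w w / Q w w)"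
  proof -
    have cont: "continuous_on C (\<lambda>w. D w w)" if "bilinear D" for D :: "'a \<Rightarrow> 'a \<Rightarrow> real"
    proof -
      have "bounded_bilinear D" using that by (simp add: bilinear_conv_bounded_bilinear)
      from bounded_bilinear.continuous_on[OF this continuous_on_id continuous_on_id] show ?thesis
        by simp
    qed
    have "Q w w \<noteq> 0" if "w \<in> C" for w
    proof -
      from that have "w \<in> T" "w \<noteq> 0" by (auto simp: C_def)
      from Tpos[OF this] show ?thesis by simp
    qed
    then show ?thesis by (intro continuous_on_divide cont B Q) auto
  qed
  ultimately obtain u where u: "u \<in> C" and umax: "\<And>w. w \<in> C \<Longrightarrow> B w w / Q w w \<le> B u u / Q u u"
    using continuous_attains_sup[of C "\<lambda>w. B w w / Q w w"] by blast
  define a where "a = B u u / Q u u"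
  have uT: "u \<in> T" "u \<noteq> 0" using u by (auto simp: C_def)
  have uS: "u \<in> S" using uT by (simp add: T_def)
  have Quu: "Q u u > 0" using Tpos uT by blast
  have le_T: "B w w \<le> a * Q w w" if w: "w \<in> T" for w
  proof (cases "w = 0")
    case True then show ?thesis by (simp add: bilinear_lzero[OF B] bilinear_lzero[OF Q])
  next
    case False
    let ?w = "(1 / norm w) *\<^sub>R w"
    have "?w \<in> C" using w False T by (simp add: C_def subspace_scale)
    from umax[OF this] have "B w w / Q w w \<le> a" using False by (simp add: bil a_def)
    then show ?thesis using Tpos[OF w False] by (simp add: field_simps)
  qed
  have le: "B v v \<le> a * Q v v" if v: "v \<in> S" for v
  proof -
    obtain z w where zw: "z \<in> Z" "w \<in> T" "v = z + w" using split[OF v] by blast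
    show ?thesis unfolding Bsplit[OF zw] using zw(2) by (rule le_T)
  qed
  \<comment> \<open>At the maximum, \<open>a Q - B\<close> is nonnegative on \<open>S\<close> and
    zero at \<open>u\<close>, so \<open>u\<close> lies in its kernel: this is the eigenvector
    equation.\<close>
  define D where "D = (\<lambda>u v. a * Q u v - B u v)"
  have D: "bilinear D" unfolding D_def bilinear_def
    by (intro conjI allI linearI) (simp_all add: bil algebra_simps)
  have "D u v = 0" if v: "v \<in> S" for v
  proof (rule psd_null_vector[OF D _ S _ uS _ v])
    show "D u v = D v u" for u v by (simp add: D_def Bsym[of u v] Qsym[of u v])
    show "0 \<le> D u u" if "u \<in> S" for u using le that by (simp add: D_def)
    show "D u u = 0" using Quu by (simp add: D_def a_def)
  qed
  then show ?thesis using uS Quu le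
    by (intro exI[of _ a] bexI[of _ u]) (simp_all add: D_def)
qed

text \<open>If the quadratic form of \<open>B\<close> takes a positive value on \<open>S\<close>,
  the largest eigenvalue is nonzero; otherwise the largest eigenvalue of \<open>- B\<close> is used,
  and it is zero only if this quadratic form vanishes on \<open>S\<close>. The nonzero eigenvalue
  matters for conics that split into two lines.\<close>

lemma generalized_eigenvector:
  fixes B Q :: "'a::euclidean_space \<Rightarrow> 'a \<Rightarrow> real"
  assumes B: "bilinear B" and Bsym: "\<And>u v. B u v = B v u"
    and Q: "bilinear Q" and Qsym: "\<And>u v. Q u v = Q v u"
    and S: "subspace S" and nonneg: "\<And>u. u \<in> S \<Longrightarrow> 0 \<le> Q u u"
    and ker: "\<And>u v. u \<in> S \<Longrightarrow> v \<in> S \<Longrightarrow> Q u u = 0 \<Longrightarrow> B u v = 0"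
    and ex: "\<exists>u\<in>S. Q u u \<noteq> 0"
  shows "\<exists>a. \<exists>u\<in>S. Q u u \<noteq> 0 \<and> (\<forall>v\<in>S. B u v = a * Q u v) \<and>
    ((\<exists>v\<in>S. B v v \<noteq> 0) \<longrightarrow> a \<noteq> 0)"
proof (cases "\<exists>v\<in>S. B v v > 0")
  case True
  obtain a u where au: "u \<in> S" "Q u u \<noteq> 0" "\<forall>v\<in>S. B u v = a * Q u v \<and> B v v \<le> a * Q v v"
    using generalized_eigenvector_max[of B Q S, OF B Bsym Q Qsym S nonneg ker ex] by blast
  moreover from True obtain v where "v \<in> S" "B v v > 0" by blast
  ultimately have "a \<noteq> 0" by force
  with au show ?thesis by blast
next
  case False
  define B' where "B' = (\<lambda>u v. - B u v)"
  have B': "bilinear B'" using B unfolding B'_def bilinear_def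
    by (auto intro!: linear_compose_neg)
  have B'sym: "B' u v = B' v u" for u v by (simp add: B'_def Bsym[of u v])
  have B'ker: "B' u v = 0" if "u \<in> S" "v \<in> S" "Q u u = 0" for u v
    using ker[OF that] by (simp add: B'_def)
  obtain a u where au: "u \<in> S" "Q u u \<noteq> 0" "\<forall>v\<in>S. B' u v = a * Q u v \<and> B' v v \<le> a * Q v v"
    using generalized_eigenvector_max[of B' Q S, OF B' B'sym Q Qsym S nonneg B'ker ex] by blast
  have "a \<noteq> 0" if v: "v \<in> S" "B v v \<noteq> 0" for v
  proof
    assume "a = 0"
    with au(3) v(1) have "0 \<le> B v v" by (simp add: B'_def)
    with False v show False by fastforce
  qed
  then show ?thesis
  proof (intro exI[of _ "- a"] bexI[of _ u] conjI ballI impI)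
    show "B u v = - a * Q u v" if "v \<in> S" for v
      using au(3) that by (force simp: B'_def)
  qed (use au in auto)
qed

text \<open>Pairing a linear relation with \<open>v t\<close> isolates the coefficient of
  \<open>v t\<close>, so these vectors are independent. It matters later that the bound on
  \<open>card T\<close> is the same for all families.\<close>

lemma orthogonal_family_finite:
  fixes Q :: "'a::euclidean_space \<Rightarrow> 'a \<Rightarrow> real" and v :: "'b \<Rightarrow> 'a"
  assumes Q: "bilinear Q" and orth: "\<And>s t. s \<in> T \<Longrightarrow> t \<in> T \<Longrightarrow> s \<noteq> t \<Longrightarrow> Q (v s) (v t) = 0"
    and nz: "\<And>t. t \<in> T \<Longrightarrow> Q (v t) (v t) \<noteq> 0"
  shows "finite T \<and> card T \<le> DIM('a)"
proof -
  have inj: "inj_on v T" by (rule inj_onI) (use nz orth in force)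
  have "independent (v ` T)"
    unfolding independent_explicit_module
  proof (intro allI impI)
    fix U f w assume U: "finite U" "U \<subseteq> v ` T" "(\<Sum>x\<in>U. f x *\<^sub>R x) = 0" "w \<in> U"
    have orth': "Q x w = 0" if "x \<in> U" "x \<noteq> w" for x
    proof -
      from U that obtain s t where "s \<in> T" "t \<in> T" "x = v s" "w = v t" by blast
      with that orth[of s t] show ?thesis by auto
    qed
    have lin: "linear (\<lambda>x. Q x w)" using Q by (simp add: bilinear_def)
    have "0 = Q (\<Sum>x\<in>U. f x *\<^sub>R x) w" using U by (simp add: bilinear_lzero[OF Q])
    also have "\<dots> = (\<Sum>x\<in>U. f x * Q x w)"
      by (simp add: linear_sum[OF lin] bilinear_lmul[OF Q])
    also have "\<dots> = (\<Sum>x\<in>{w}. f x * Q x w)"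
      using U orth' by (intro sum.mono_neutral_right) auto
    finally have "f w * Q w w = 0" by simp
    moreover have "Q w w \<noteq> 0" using U nz by auto
    ultimately show "f w = 0" by simp
  qed
  then have "finite (v ` T)" "card (v ` T) \<le> DIM('a)"
    using independent_bound by blast+
  then show ?thesis using inj by (simp add: card_image finite_image_iff)
qed

subsection \<open>Coordinates on spaces of forms\<close>

text \<open>The degree is encoded as the size of the index type \<open>'d\<close>, so that
  coefficient vectors have the Euclidean space \<open>real ^ ('n, 'd) mono\<close> as their
  type.\<close>

typedef ('n, 'd) mono = "{m :: 'n::finite \<Rightarrow>\<^sub>0 nat. mono_degree m = CARD('d::finite)}"
  by (rule exI[of _ "Poly_Mapping.single undefined CARD('d)"]) simp

lemma finite_mono_degree: "finite {m :: 'n::finite \<Rightarrow>\<^sub>0 nat. mono_degree m = d}"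
proof (rule finite_imageD)
  have "Poly_Mapping.lookup m i \<le> mono_degree m" for m :: "'n \<Rightarrow>\<^sub>0 nat" and i
    unfolding mono_degree_def by (rule member_le_sum) auto
  then have "Poly_Mapping.lookup ` {m :: 'n \<Rightarrow>\<^sub>0 nat. mono_degree m = d} \<subseteq> PiE UNIV (\<lambda>_. {..d})"
    by auto
  then show "finite (Poly_Mapping.lookup ` {m :: 'n \<Rightarrow>\<^sub>0 nat. mono_degree m = d})"
    by (rule finite_subset) (simp add: finite_PiE)
  show "inj_on Poly_Mapping.lookup {m :: 'n \<Rightarrow>\<^sub>0 nat. mono_degree m = d}"
    by (auto simp: inj_on_def intro: poly_mapping_eqI)
qed

lemma bij_Rep_mono:
  "bij_betw Rep_mono (UNIV :: ('n::finite, 'd::finite) mono set) {m. mono_degree m = CARD('d)}"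
  using type_definition.Rep_range[OF type_definition_mono]
  by (simp add: bij_betw_def inj_on_def Rep_mono_inject)

instance mono :: (finite, finite) finite
  by standard (use bij_betw_finite[OF bij_Rep_mono] finite_mono_degree in blast)

text \<open>The first two exponents, of sum at most the degree, determine the third. The values used
  are 6 for ternary quadratic forms and 10 for ternary cubics.\<close>

lemma card_mono3: "CARD((3, 'd::finite) mono) = (\<Sum>i\<le>CARD('d). CARD('d) - i + 1)"
proof -
  let ?d = "CARD('d)" and ?A = "{m :: 3 \<Rightarrow>\<^sub>0 nat. mono_degree m = CARD('d)}"
  have deg: "mono_degree m = Poly_Mapping.lookup m 1 + Poly_Mapping.lookup m 2 + Poly_Mapping.lookup m 3"
    for m :: "3 \<Rightarrow>\<^sub>0 nat"
    by (simp add: mono_degree_def sum_3)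
  have "bij_betw (\<lambda>m. (Poly_Mapping.lookup m 1, Poly_Mapping.lookup m 2)) ?A (SIGMA i:{..?d}. {..?d - i})"
  proof (rule bij_betwI')
    fix m m' :: "3 \<Rightarrow>\<^sub>0 nat" assume "m \<in> ?A" "m' \<in> ?A"
    then show "((Poly_Mapping.lookup m 1, Poly_Mapping.lookup m 2)
        = (Poly_Mapping.lookup m' 1, Poly_Mapping.lookup m' 2)) = (m = m')"
      by (auto simp: deg poly_mapping_eq_iff fun_eq_iff forall_3)
  next
    fix m :: "3 \<Rightarrow>\<^sub>0 nat" assume "m \<in> ?A"
    then show "(Poly_Mapping.lookup m 1, Poly_Mapping.lookup m 2) \<in> (SIGMA i:{..?d}. {..?d - i})"
      by (auto simp: deg)
  next
    fix y assume "y \<in> (SIGMA i:{..?d}. {..?d - i})"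
    then obtain i j where ij: "y = (i, j)" "i + j \<le> ?d" by fastforce
    let ?m = "Poly_Mapping.single (1::3) i + Poly_Mapping.single 2 j + Poly_Mapping.single 3 (?d - i - j)"
    have "?m \<in> ?A" "y = (Poly_Mapping.lookup ?m 1, Poly_Mapping.lookup ?m 2)"
      using ij by (auto simp: mono_degree_add lookup_add lookup_single when_def)
    then show "\<exists>m\<in>?A. y = (Poly_Mapping.lookup m 1, Poly_Mapping.lookup m 2)" by blast
  qed
  then have "card ?A = card (SIGMA i:{..?d}. {..?d - i})" by (rule bij_betw_same_card)
  moreover have "card ?A = CARD((3, 'd) mono)"
    using bij_betw_same_card[OF bij_Rep_mono] by metis
  ultimately show ?thesis by simp
qed

definition form_of :: "real ^ ('n::finite, 'd::finite) mono \<Rightarrow> 'n real_mpoly" where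
  "form_of v = (\<Sum>m\<in>UNIV. Poly_Mapping.single (Rep_mono m) (v $ m))"

text \<open>Coefficients in other degrees are discarded; on forms of degree \<open>CARD('d)\<close>
  this is inverse to \<open>form_of\<close>.\<close>

definition coords :: "'n::finite real_mpoly \<Rightarrow> real ^ ('n, 'd::finite) mono" where
  "coords p = (\<chi> m. Poly_Mapping.lookup p (Rep_mono m))"

lemma form_of_forms: "form_of (v :: real ^ ('n::finite, 'd::finite) mono) \<in> forms CARD('d)"
  unfolding form_of_def
proof (intro forms_sum forms_single)
  fix m :: "('n, 'd) mono"
  show "mono_degree (Rep_mono m) = CARD('d)" using Rep_mono[of m] by simp
qed

lemma lookup_form_of:
  "Poly_Mapping.lookup (form_of v) (Rep_mono m) = v $ m"
proof -
  have "Poly_Mapping.lookup (form_of v) (Rep_mono m) = (\<Sum>k\<in>UNIV. if k = m then v $ k else 0)"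
    unfolding form_of_def lookup_sum
    by (intro sum.cong) (auto simp: lookup_single when_def Rep_mono_inject)
  then show ?thesis by simp
qed

lemma coords_form_of [simp]: "coords (form_of v) = v"
  by (simp add: vec_eq_iff coords_def lookup_form_of)

lemma form_of_coords:
  assumes "p \<in> forms CARD('d::finite)"
  shows "form_of (coords p :: real ^ ('n::finite, 'd) mono) = p"
proof (rule poly_mapping_eqI)
  let ?v = "coords p :: real ^ ('n, 'd) mono"
  fix m :: "'n \<Rightarrow>\<^sub>0 nat"
  show "Poly_Mapping.lookup (form_of ?v) m = Poly_Mapping.lookup p m"
  proof (cases "mono_degree m = CARD('d)")
    case True
    then obtain k :: "('n, 'd) mono" where "m = Rep_mono k"
      by (metis (mono_tags) Rep_mono_cases mem_Collect_eq)
    then show ?thesis by (simp add: lookup_form_of) (simp add: coords_def)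
  next
    case False
    then show ?thesis
      using assms form_of_forms[of ?v] unfolding forms_iff by metis
  qed
qed

lemma form_of_add: "form_of (u + v) = form_of u + form_of v"
  by (simp add: form_of_def single_add sum.distrib)

lemma form_of_scaleR: "form_of (c *\<^sub>R v) = const_poly c * form_of v"
  by (simp add: form_of_def const_poly_def sum_distrib_left mult_single)

lemma coords_add: "coords (p + q) = coords p + coords q"
  by (simp add: coords_def vec_eq_iff lookup_add)

lemma coords_const_mult: "coords (const_poly c * p) = c *\<^sub>R coords p"
  by (simp add: coords_def vec_eq_iff)

lemma form_of_0 [simp]: "form_of 0 = 0"
  by (simp add: form_of_def)

lemma form_of_eq_0_iff [simp]: "form_of v = 0 \<longleftrightarrow> v = 0"
proof
  assume "form_of v = 0"
  then have "coords (form_of v) = (coords 0 :: real ^ ('a, 'b) mono)" by simp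
  then show "v = 0" by (simp add: coords_def[of 0] vec_eq_iff)
qed (simp add: form_of_def)

subsection \<open>Linear functionals on polynomials\<close>

definition poly_linear :: "('n real_mpoly \<Rightarrow> real) \<Rightarrow> bool" where
  "poly_linear L \<longleftrightarrow> (\<forall>p q. L (p + q) = L p + L q) \<and> (\<forall>c p. L (const_poly c * p) = c * L p)"

lemma
  assumes "poly_linear L"
  shows poly_linear_add: "L (p + q) = L p + L q"
    and poly_linear_const_mult: "L (const_poly c * p) = c * L p"
    and poly_linear_0: "L 0 = 0"
    and poly_linear_uminus: "L (- p) = - L p"
    and poly_linear_diff: "L (p - q) = L p - L q"
proof -
  show add: "L (p + q) = L p + L q" and mult: "L (const_poly c * p) = c * L p" for p q c
    using assms by (simp_all add: poly_linear_def)
  show "L 0 = 0" using mult[of 0] by simp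
  show uminus: "L (- p) = - L p" for p
    using mult[of "- 1" p] by (simp add: const_poly_uminus)
  show "L (p - q) = L p - L q"
    using add[of p "- q"] uminus by simp
qed

lemma poly_linear_sum: "poly_linear L \<Longrightarrow> L (sum f I) = (\<Sum>i\<in>I. L (f i))"
  by (induction I rule: infinite_finite_induct) (auto simp: poly_linear_0 poly_linear_add)

lemma poly_linear_mult: "poly_linear L \<Longrightarrow> poly_linear (\<lambda>p. L (q * p))"
  by (simp add: poly_linear_def distrib_left mult.left_commute[of q])

lemma forms_power:
  assumes "w \<in> forms (Suc 0)"
  shows "w ^ j \<in> forms j"
proof (induction j)
  case 0
  show ?case using const_poly_forms[of 1] by simp
next
  case (Suc j)
  show ?case using forms_mult[OF assms Suc.IH] by simp
qed

text \<open>Each variable of \<open>f\<close> is traded for a factor \<open>w\<close> at the price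
  of the number \<open>x $ i\<close>; when no variable is left, only \<open>w ^ Suc d\<close>
  remains. The exponent \<open>j\<close> counts the trades already made. For \<open>j = 0\<close>,
  \<open>L\<close> is a multiple of evaluation at \<open>x\<close>.\<close>

lemma functional_eq_eval:
  fixes L :: "'n::finite real_mpoly \<Rightarrow> real"
  assumes L: "poly_linear L" and w: "w \<in> forms (Suc 0)"
    and act: "\<And>i m. m \<in> forms d \<Longrightarrow> L (poly_var i * m) = x $ i * L (w * m)"
  shows "f \<in> forms k \<Longrightarrow> k + j = Suc d \<Longrightarrow> L (f * w ^ j) = mpoly_eval f x * L (w ^ Suc d)"
proof (induction k arbitrary: f j)
  case 0
  then obtain c where "f = const_poly c" using forms_0_const by blast
  with 0 show ?case by (simp add: poly_linear_const_mult[OF L])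
next
  case (Suc k)
  obtain r where r: "\<And>i. r i \<in> forms k" "f = (\<Sum>i\<in>UNIV. poly_var i * r i)"
    using Suc.prems(1) forms_Suc_decompose by blast
  have "L (poly_var i * r i * w ^ j) = x $ i * mpoly_eval (r i) x * L (w ^ Suc d)" for i
  proof -
    have "r i * w ^ j \<in> forms d"
      using forms_mult[OF r(1)[of i] forms_power[OF w, of j]] Suc.prems(2) by simp
    then have "L (poly_var i * (r i * w ^ j)) = x $ i * L (w * (r i * w ^ j))" by (rule act)
    also have "L (w * (r i * w ^ j)) = L (r i * w ^ Suc j)" by (simp add: mult_ac)
    also have "\<dots> = mpoly_eval (r i) x * L (w ^ Suc d)"
      using Suc.prems(2) by (intro Suc.IH r(1)) simp
    finally show ?thesis by (simp add: mult_ac)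
  qed
  then have "L (f * w ^ j) = (\<Sum>i\<in>UNIV. x $ i * mpoly_eval (r i) x * L (w ^ Suc d))"
    unfolding r(2) sum_distrib_right poly_linear_sum[OF L] by (intro sum.cong) auto
  then show ?case by (simp add: r(2) mpoly_eval_sum mpoly_eval_mult sum_distrib_right)
qed

text \<open>Being nonzero, \<open>L\<close> is a nonzero multiple of evaluation at \<open>x\<close>,
  so vanishing of \<open>L\<close> means vanishing at \<open>x\<close>. The point is not the origin
  because \<open>f0\<close>, of positive degree, does not vanish there.\<close>

lemma functional_common_zero:
  fixes L :: "'n::finite real_mpoly \<Rightarrow> real"
  assumes L: "poly_linear L" and w: "w \<in> forms (Suc 0)"
    and act: "\<And>i m. m \<in> forms d \<Longrightarrow> L (poly_var i * m) = x $ i * L (w * m)"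
    and nz: "f0 \<in> forms (Suc d)" "L f0 \<noteq> 0"
    and W: "W \<subseteq> forms (Suc d)" "\<And>f. f \<in> W \<Longrightarrow> L f = 0"
  shows "x \<noteq> 0 \<and> (\<forall>f\<in>W. mpoly_eval f x = 0)"
proof -
  have eq: "L f = mpoly_eval f x * L (w ^ Suc d)" if "f \<in> forms (Suc d)" for f
    using functional_eq_eval[OF L w act that, where j = 0] by simp
  with nz have nz': "L (w ^ Suc d) \<noteq> 0" "mpoly_eval f0 x \<noteq> 0" by auto
  show ?thesis
  proof (intro conjI ballI)
    show "x \<noteq> 0" using nz'(2) mpoly_eval_form_0[OF nz(1)] by auto
    show "mpoly_eval f x = 0" if "f \<in> W" for f
      using eq[of f] W that nz'(1) by auto
  qed
qed

subsection \<open>Nonnegative functionals and their kernels\<close>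

text \<open>In three variables, \<open>X\<close>, \<open>Y\<close>, \<open>Z\<close> are linear
  coordinates; invertibility is expressed by solving for the original variables.\<close>

definition spanning_linear_forms :: "'n::finite real_mpoly \<Rightarrow> 'n real_mpoly \<Rightarrow> 'n real_mpoly \<Rightarrow> bool" where
  "spanning_linear_forms X Y Z \<longleftrightarrow> X \<in> forms 1 \<and> Y \<in> forms 1 \<and> Z \<in> forms 1 \<and>
    (\<forall>i. \<exists>a b c. poly_var i = const_poly a * X + const_poly b * Y + const_poly c * Z)"

locale psd_functional =
  fixes L :: "'n::finite real_mpoly \<Rightarrow> real" and d :: nat
  assumes lin: "poly_linear L"
    and psd: "f \<in> forms d \<Longrightarrow> 0 \<le> L (f * f)"
begin

text \<open>This is the space \<open>W\<close> of the overview, the radical of a positive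
  semidefinite form.\<close>

definition null_forms :: "'n real_mpoly set" where
  "null_forms = {f \<in> forms d. \<forall>h\<in>forms d. L (f * h) = 0}"

lemmas L_simps = poly_linear_add[OF lin] poly_linear_const_mult[OF lin] poly_linear_0[OF lin]
  poly_linear_uminus[OF lin] poly_linear_diff[OF lin]

text \<open>Cauchy-Schwarz for \<open>L (f * h)\<close>, obtained by expanding \<open>L\<close> on
  the square of \<open>f + t h\<close>.\<close>

lemma null_forms_iff: "f \<in> null_forms \<longleftrightarrow> f \<in> forms d \<and> L (f * f) = 0"
proof
  assume f: "f \<in> forms d \<and> L (f * f) = 0"
  have "L (f * h) = 0" if h: "h \<in> forms d" for h
  proof (rule quadratic_nonneg_imp_linear_zero)
    fix t :: real
    have "0 \<le> L ((f + const_poly t * h) * (f + const_poly t * h))"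
      using f h by (intro psd) auto
    also have "(f + const_poly t * h) * (f + const_poly t * h)
        = f * f + const_poly (2 * t) * (f * h) + const_poly (t\<^sup>2) * (h * h)"
    proof -
      have two: "const_poly (2 * t) = const_poly t + const_poly t"
        by (simp flip: const_poly_add)
      show ?thesis unfolding two
        by (simp add: power2_eq_square const_poly_mult algebra_simps)
    qed
    finally show "0 \<le> 2 * t * L (f * h) + t\<^sup>2 * L (h * h)"
      using f by (simp add: L_simps)
  qed
  with f show "f \<in> null_forms" by (simp add: null_forms_def)
qed (simp add: null_forms_def)

lemma null_forms_mult:
  assumes "f \<in> null_forms" "h \<in> forms d"
  shows "L (f * h) = 0" "L (h * f) = 0"
  using assms by (auto simp: null_forms_def mult.commute)

lemma null_forms_subset: "null_forms \<subseteq> forms d"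
  by (auto simp: null_forms_def)

lemma null_forms_add: "f \<in> null_forms \<Longrightarrow> g \<in> null_forms \<Longrightarrow> f + g \<in> null_forms"
  by (auto simp: null_forms_def distrib_right L_simps)

lemma null_forms_const_mult: "f \<in> null_forms \<Longrightarrow> const_poly c * f \<in> null_forms"
  by (auto simp: null_forms_def mult.assoc L_simps)

lemma null_forms_sum: "(\<And>i. i \<in> I \<Longrightarrow> f i \<in> null_forms) \<Longrightarrow> sum f I \<in> null_forms"
  by (induction I rule: infinite_finite_induct)
    (auto simp: null_forms_add, auto simp: null_forms_def L_simps)

text \<open>Turns products of forms, parametrized by coordinate vectors, into the bilinear forms of
  the eigenvector lemmas.\<close>

lemma bilinear_functional:
  fixes u v :: "'a::real_vector \<Rightarrow> 'n real_mpoly"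
  assumes "\<And>x y. u (x + y) = u x + u y" "\<And>c x. u (c *\<^sub>R x) = const_poly c * u x"
    and "\<And>x y. v (x + y) = v x + v y" "\<And>c x. v (c *\<^sub>R x) = const_poly c * v x"
  shows "bilinear (\<lambda>x y. L (u x * v y))"
  unfolding bilinear_def
  by (intro conjI allI linearI)
    (simp_all add: assms L_simps algebra_simps mult.left_commute[of "u _" "const_poly _"])

text \<open>The functional \<open>p \<mapsto> L (h * p)\<close> vanishes on \<open>W\<close> but not
  at \<open>h\<close>. As the coordinates act on it like numbers relative to \<open>w\<close>, it is
  a multiple of evaluation at the point given by the values \<open>a\<close>, \<open>b\<close>,
  \<open>c\<close> for \<open>X\<close>, \<open>Y\<close>, \<open>Z\<close>.\<close>

lemma common_zero:
  assumes d: "d = Suc e" and h: "h \<in> forms d" "h \<notin> null_forms"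
    and lin3: "spanning_linear_forms X Y Z" and w: "w \<in> forms 1"
    and act: "\<And>m. m \<in> forms e \<Longrightarrow> L (h * (X * m)) = a * L (h * (w * m))"
      "\<And>m. m \<in> forms e \<Longrightarrow> L (h * (Y * m)) = b * L (h * (w * m))"
      "\<And>m. m \<in> forms e \<Longrightarrow> L (h * (Z * m)) = c * L (h * (w * m))"
  shows "\<exists>x. x \<noteq> 0 \<and> (\<forall>f\<in>null_forms. mpoly_eval f x = 0)"
proof -
  from lin3 obtain A B C where ABC:
    "\<And>i. poly_var i = const_poly (A i) * X + const_poly (B i) * Y + const_poly (C i) * Z"
    unfolding spanning_linear_forms_def by metis
  define x where "x = (\<chi> i. A i * a + B i * b + C i * c)"
  have "x \<noteq> 0 \<and> (\<forall>f\<in>null_forms. mpoly_eval f x = 0)"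
  proof (rule functional_common_zero[where d = e])
    show "poly_linear (\<lambda>p. L (h * p))" by (rule poly_linear_mult[OF lin])
    show "w \<in> forms (Suc 0)" using w by simp
    show "L (h * (poly_var i * m)) = x $ i * L (h * (w * m))" if m: "m \<in> forms e" for i m
    proof -
      have "h * (poly_var i * m) = const_poly (A i) * (h * (X * m)) + const_poly (B i) * (h * (Y * m))
          + const_poly (C i) * (h * (Z * m))"
        by (simp add: ABC algebra_simps)
      then have "L (h * (poly_var i * m))
          = A i * L (h * (X * m)) + B i * L (h * (Y * m)) + C i * L (h * (Z * m))"
        by (simp only: L_simps)
      then show ?thesis by (simp only: act[OF m]) (simp add: x_def algebra_simps)
    qed
    show "h \<in> forms (Suc e)" "L (h * h) \<noteq> 0"
      using h d null_forms_iff by auto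
    show "null_forms \<subseteq> forms (Suc e)" using null_forms_subset d by simp
    show "L (h * f) = 0" if "f \<in> null_forms" for f
      using null_forms_mult(2)[OF that h(1)] .
  qed
  then show ?thesis by blast
qed

end

section \<open>Ternary cubics: a linear form without null multiples, and the opposite case\<close>

locale psd_functional_cubics = psd_functional L 3 for L :: "3 real_mpoly \<Rightarrow> real"
begin

abbreviation quad :: "real ^ (3, 2) mono \<Rightarrow> 3 real_mpoly" where
  "quad \<equiv> form_of"

lemma quad_forms [simp]: "quad u \<in> forms 2"
  using form_of_forms[of u] by simp

lemma quad_coords: "g \<in> forms 2 \<Longrightarrow> quad (coords g) = g"
  by (rule form_of_coords) simp

lemma linear_mult_quadratic: "w \<in> forms 1 \<Longrightarrow> g \<in> forms 2 \<Longrightarrow> w * g \<in> forms 3"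
  by (rule forms_mult') auto

lemma bilinear_quad: "bilinear (\<lambda>u v. L (x * quad u * (y * quad v)))"
  by (rule bilinear_functional) (simp_all add: form_of_add form_of_scaleR algebra_simps)

text \<open>Modulo \<open>W\<close>, multiplication by \<open>n / l\<close> is the operator that
  sends \<open>g\<close> to the \<open>g'\<close> of \<open>flat\<close>; multiplication by
  \<open>m / l\<close> enters only through its bilinear form. Both are symmetric for
  \<open>Q\<close>, and a common eigenvector \<open>g\<close> makes
  \<open>p \<mapsto> L (l * g * p)\<close> a multiple of a point evaluation.\<close>

lemma common_zero_if_flat:
  assumes lin3: "spanning_linear_forms l m n"
    and inj: "\<And>g. g \<in> forms 2 \<Longrightarrow> l * g \<in> null_forms \<Longrightarrow> g = 0"
    and flat: "\<And>g. g \<in> forms 2 \<Longrightarrow> \<exists>g'\<in>forms 2. n * g - l * g' \<in> null_forms"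
  shows "\<exists>x. x \<noteq> 0 \<and> (\<forall>f\<in>null_forms. mpoly_eval f x = 0)"
proof -
  have l: "l \<in> forms 1" and m: "m \<in> forms 1" and n: "n \<in> forms 1"
    using lin3 by (auto simp: spanning_linear_forms_def)
  define Q where "Q u v = L (l * quad u * (l * quad v))" for u v
  define Bm where "Bm u v = L (l * quad u * (m * quad v))" for u v
  define Bn where "Bn u v = L (l * quad u * (n * quad v))" for u v
  have bil: "bilinear Q" "bilinear Bm" "bilinear Bn"
    unfolding Q_def Bm_def Bn_def by (rule bilinear_quad)+
  have sym: "Q u v = Q v u" "Bm u v = Bm v u" "Bn u v = Bn v u" for u v
    by (simp_all add: Q_def Bm_def Bn_def mult_ac)
  have Qnonneg: "0 \<le> Q u u" for u
    unfolding Q_def by (intro psd linear_mult_quadratic l) simp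
  \<comment> \<open>Positive definiteness of \<open>Q\<close> is the hypothesis
    \<open>inj\<close>.\<close>
  have Q0: "u = 0" if "Q u u = 0" for u
  proof -
    have "l * quad u \<in> null_forms"
      using that linear_mult_quadratic[OF l] by (simp add: null_forms_iff Q_def)
    then show ?thesis using inj[of "quad u"] by simp
  qed
  have ker: "Bm u v = 0" "Bn u v = 0" if "Q u u = 0" for u v
    using Q0[OF that] bil by (simp_all add: bilinear_lzero)
  have ex: "\<exists>u\<in>UNIV. Q u u \<noteq> 0"
    using Q0[of 1] by (metis UNIV_I zero_neq_one)
  obtain a u1 where u1: "Q u1 u1 \<noteq> 0" "\<And>v. Bm u1 v = a * Q u1 v"
    using generalized_eigenvector[of Bm Q UNIV, OF bil(2) sym(2) bil(1) sym(1) subspace_UNIV Qnonneg ker(1) ex]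
    by blast
  \<comment> \<open>The eigenspace of multiplication by \<open>m / l\<close> for the eigenvalue
    \<open>a\<close>.\<close>
  define S where "S = {u. \<forall>v. Bm u v = a * Q u v}"
  have S: "subspace S"
    unfolding subspace_def S_def
    by (simp add: bil[THEN bilinear_lzero] bil[THEN bilinear_ladd] bil[THEN bilinear_lmul] algebra_simps)
  have "\<exists>u\<in>S. Q u u \<noteq> 0" using u1 by (auto simp: S_def)
  from generalized_eigenvector[of Bn Q S, OF bil(3) sym(3) bil(1) sym(1) S Qnonneg ker(2) this]
  obtain b u2 where u2: "u2 \<in> S" "Q u2 u2 \<noteq> 0" "\<And>v. v \<in> S \<Longrightarrow> Bn u2 v = b * Q u2 v"
    by blast
  define g where "g = quad u2"
  have g: "g \<in> forms 2" by (simp add: g_def)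
  have Sg: "L (l * h * (m * h')) = a * L (l * h * (l * h'))"
    if "h \<in> forms 2" "h' \<in> forms 2" "coords h \<in> S" for h h'
    using that(3) quad_coords[OF that(1)] quad_coords[OF that(2)]
    unfolding S_def Bm_def Q_def by (metis (mono_tags, lifting) mem_Collect_eq)
  have gS: "coords g \<in> S" using u2 by (simp add: g_def)
  obtain g2 where g2: "g2 \<in> forms 2" "n * g - l * g2 \<in> null_forms" using flat[OF g] by blast
  define w where "w = n * g - l * g2"
  have w: "w \<in> null_forms" "n * g = l * g2 + w" using g2 by (simp_all add: w_def)
  note forms3 = linear_mult_quadratic
  \<comment> \<open>Multiplication by \<open>n / l\<close> preserves \<open>S\<close>: the factor
    \<open>n\<close> is moved from \<open>g\<close> to \<open>h\<close>, replaced there by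
    \<open>l\<close> times \<open>h2\<close> modulo \<open>W\<close>, and moved back after the
    eigenvector equation of \<open>g\<close> has been applied.\<close>
  have g2S: "coords g2 \<in> S"
    unfolding S_def
  proof (clarify)
    fix v
    define h where "h = quad v"
    have h: "h \<in> forms 2" by (simp add: h_def)
    obtain h2 where h2: "h2 \<in> forms 2" "n * h - l * h2 \<in> null_forms" using flat[OF h] by blast
    define w' where "w' = n * h - l * h2"
    have w': "w' \<in> null_forms" "n * h = l * h2 + w'" using h2 by (simp_all add: w'_def)
    have "L (l * g2 * (m * h)) = L (n * g * (m * h)) - L (w * (m * h))"
      by (simp only: w(2)) (simp add: distrib_right L_simps)
    also have "\<dots> = L (m * g * (n * h))"
      using null_forms_mult(1)[OF w(1) forms3[OF m h]] by (simp add: mult_ac)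
    also have "\<dots> = L (l * g * (m * h2)) + L (m * g * w')"
      by (simp only: w'(2)) (simp add: algebra_simps L_simps)
    also have "\<dots> = a * L (l * g * (l * h2))"
      using null_forms_mult(2)[OF w'(1) forms3[OF m g]] Sg[OF g h2(1) gS] by simp
    also have "L (l * g * (l * h2)) = L (l * g * (n * h)) - L (l * g * w')"
      by (simp only: w'(2)) (simp add: algebra_simps L_simps)
    also have "\<dots> = L (n * g * (l * h))"
      using null_forms_mult(2)[OF w'(1) forms3[OF l g]] by (simp add: mult_ac)
    also have "\<dots> = L (l * g2 * (l * h)) + L (w * (l * h))"
      by (simp only: w(2)) (simp add: distrib_right L_simps)
    also have "\<dots> = L (l * g2 * (l * h))"
      using null_forms_mult(1)[OF w(1) forms3[OF l h]] by simp
    finally show "Bm (coords g2) v = a * Q (coords g2) v"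
      by (simp add: Bm_def Q_def quad_coords[OF g2(1)] h_def)
  qed
  \<comment> \<open>The eigenvector equation of \<open>u2\<close> for \<open>n / l\<close> is known
    only against \<open>S\<close>. As \<open>c\<close> itself lies in \<open>S\<close>, it yields
    \<open>Q c c = 0\<close>, so the equation holds against all vectors.\<close>
  define c where "c = coords g2 - b *\<^sub>R u2"
  have cS: "c \<in> S" unfolding c_def by (intro subspace_diff subspace_scale S g2S u2)
  have Qg2: "Q (coords g2) v = Bn u2 v" for v
  proof -
    have "Bn u2 v = L (n * g * (l * quad v))"
      by (simp add: Bn_def g_def mult_ac)
    also have "\<dots> = L (l * g2 * (l * quad v)) + L (w * (l * quad v))"
      by (simp only: w(2)) (simp add: distrib_right L_simps)
    also have "L (w * (l * quad v)) = 0"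
      by (intro null_forms_mult(1) w forms3 l) simp
    finally show ?thesis by (simp add: Q_def quad_coords[OF g2(1)])
  qed
  have "Q c c = Q (coords g2) c - b * Q u2 c"
    unfolding c_def by (simp add: bilinear_lsub[OF bil(1)] bilinear_lmul[OF bil(1)])
  also have "\<dots> = 0" using Qg2 u2(3)[OF cS] by simp
  finally have "c = 0" by (rule Q0)
  then have c0: "coords g2 = b *\<^sub>R u2" by (simp add: c_def)
  \<comment> \<open>The common zero has the values \<open>l = 1\<close>, \<open>m = a\<close>,
    \<open>n = b\<close>.\<close>
  show ?thesis
  proof (rule common_zero[where e = 2 and w = l and a = 1 and b = a and c = b, OF _ _ _ lin3 l])
    show "l * g \<in> forms 3" by (rule forms3[OF l g])
    show "l * g \<notin> null_forms" using u2(2) by (simp add: null_forms_iff Q_def g_def)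
    fix h :: "3 real_mpoly" assume h: "h \<in> forms 2"
    show "L (l * g * (m * h)) = a * L (l * g * (l * h))" by (rule Sg[OF g h gS])
    have "L (l * g * (n * h)) = Bn u2 (coords h)"
      by (simp add: Bn_def g_def quad_coords[OF h])
    also have "\<dots> = b * Q u2 (coords h)"
      by (simp add: Qg2[symmetric] c0 bilinear_lmul[OF bil(1)])
    finally show "L (l * g * (n * h)) = b * L (l * g * (l * h))"
      by (simp add: Q_def g_def quad_coords[OF h])
  qed simp_all
qed

text \<open>In a pencil \<open>k + t r\<close>, two members differ by a multiple of
  \<open>r\<close>, so the products \<open>r * g t\<close> are pairwise orthogonal and only a
  bounded number of them are not null. A pair \<open>(s, t)\<close> exceptional for neither
  \<open>y\<close> nor \<open>z\<close> gives a \<open>g\<close> with \<open>y * g\<close> and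
  \<open>z * g\<close> null, hence \<open>x * g\<close> as well.\<close>

lemma null_conic_if_all_degenerate:
  fixes x y z :: "3 real_mpoly"
  assumes xyz: "x \<in> forms 1" "y \<in> forms 1" "z \<in> forms 1"
    and deg: "\<And>s t. \<exists>g\<in>forms 2. g \<noteq> 0 \<and> (x + const_poly s * y + const_poly t * z) * g \<in> null_forms"
  shows "\<exists>g\<in>forms 2. g \<noteq> 0 \<and> x * g \<in> null_forms \<and> y * g \<in> null_forms \<and> z * g \<in> null_forms"
proof -
  define l where "l s t = x + const_poly s * y + const_poly t * z" for s t
  obtain G where G: "\<And>s t. G s t \<in> forms 2" "\<And>s t. G s t \<noteq> 0" "\<And>s t. l s t * G s t \<in> null_forms"
    using deg unfolding l_def by metis
  have key: "finite T \<and> card T \<le> DIM(real ^ (3, 2) mono)"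
    if r: "r \<in> forms 1" and Gr: "\<And>t. t \<in> T \<Longrightarrow> g t \<in> forms 2"
      "\<And>t. t \<in> T \<Longrightarrow> (k + const_poly t * r) * g t \<in> null_forms"
      "\<And>t. t \<in> T \<Longrightarrow> L (r * g t * (r * g t)) \<noteq> 0" for r k and g :: "real \<Rightarrow> 3 real_mpoly" and T
  proof (rule orthogonal_family_finite[where v = "\<lambda>t. coords (g t)", OF bilinear_quad[of r r]])
    fix s t assume st: "s \<in> T" "t \<in> T" "s \<noteq> t"
    have "const_poly (s - t) * (r * g s * (r * g t))
        = (k + const_poly s * r) * g s * (r * g t) - r * g s * ((k + const_poly t * r) * g t)"
      by (simp add: const_poly_diff algebra_simps)
    then have "(s - t) * L (r * g s * (r * g t)) = 0"
      using null_forms_mult(1)[OF Gr(2)[OF st(1)] linear_mult_quadratic[OF r Gr(1)[OF st(2)]]]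
        null_forms_mult(2)[OF Gr(2)[OF st(2)] linear_mult_quadratic[OF r Gr(1)[OF st(1)]]]
      by (metis L_simps(2) L_simps(5) diff_zero)
    then show "L (r * quad (coords (g s)) * (r * quad (coords (g t)))) = 0"
      using st by (simp add: quad_coords Gr)
  next
    fix t assume "t \<in> T"
    then show "L (r * quad (coords (g t)) * (r * quad (coords (g t)))) \<noteq> 0"
      using Gr by (simp add: quad_coords)
  qed
  define N where "N = DIM(real ^ (3, 2) mono)"
  define Ty where "Ty t = {s. L (y * G s t * (y * G s t)) \<noteq> 0}" for t
  define Tz where "Tz s = {t. L (z * G s t * (z * G s t)) \<noteq> 0}" for s
  have Tz: "finite (Tz s)" for s
  proof -
    have "finite (Tz s) \<and> card (Tz s) \<le> DIM(real ^ (3, 2) mono)"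
    proof (rule key[OF xyz(3), where g = "G s" and k = "x + const_poly s * y"])
      show "(x + const_poly s * y + const_poly t * z) * G s t \<in> null_forms" for t
        using G(3)[of s t] by (simp add: l_def)
    qed (simp_all add: G Tz_def)
    then show ?thesis by blast
  qed
  have Ty: "finite (Ty t) \<and> card (Ty t) \<le> N" for t
    unfolding N_def
  proof (rule key[OF xyz(2), where g = "\<lambda>s. G s t" and k = "x + const_poly t * z"])
    fix s
    have "x + const_poly t * z + const_poly s * y = l s t" by (simp add: l_def)
    then show "(x + const_poly t * z + const_poly s * y) * G s t \<in> null_forms" using G by simp
  qed (simp_all add: G Ty_def)
  \<comment> \<open>First \<open>N + 1\<close> values of \<open>s\<close> are fixed, then
    \<open>t\<close> is chosen outside the exceptional sets of all of them. The set
    \<open>Ty t\<close> depends on this \<open>t\<close>, but with at most \<open>N\<close> elements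
    it misses one of the values of \<open>s\<close>.\<close>
  define S where "S = real ` {..N}"
  have S: "finite S" "card S = Suc N" by (simp_all add: S_def card_image)
  have "finite (\<Union>s\<in>S. Tz s)" using S Tz by blast
  then obtain t where t: "t \<notin> (\<Union>s\<in>S. Tz s)"
    using ex_new_if_finite infinite_UNIV_char_0 by blast
  have "\<not> S \<subseteq> Ty t"
  proof
    assume "S \<subseteq> Ty t"
    then have "card S \<le> card (Ty t)" using Ty by (intro card_mono) auto
    with Ty[of t] S show False by simp
  qed
  then obtain s where s: "s \<in> S" "s \<notin> Ty t" by blast
  define g where "g = G s t"
  have g: "g \<in> forms 2" "g \<noteq> 0" "l s t * g \<in> null_forms" using G by (simp_all add: g_def)
  have yg: "y * g \<in> null_forms" and zg: "z * g \<in> null_forms"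
    using s t g(1) xyz by (auto simp: null_forms_iff linear_mult_quadratic Ty_def Tz_def g_def)
  have "x * g = l s t * g + const_poly (- s) * (y * g) + const_poly (- t) * (z * g)"
    by (simp add: l_def const_poly_uminus algebra_simps)
  then have "x * g \<in> null_forms"
    using g(3) yg zg by (simp only: null_forms_add null_forms_const_mult)
  then show ?thesis using g yg zg by blast
qed

end

section \<open>Changes of linear coordinates\<close>

lemma spanning_linear_forms_perm:
  assumes "spanning_linear_forms X Y Z"
  shows "spanning_linear_forms Z Y X" "spanning_linear_forms X Z Y" "spanning_linear_forms Y X Z"
proof -
  from assms obtain a b c where abc:
    "\<And>i. poly_var i = const_poly (a i) * X + const_poly (b i) * Y + const_poly (c i) * Z"
    unfolding spanning_linear_forms_def by metis
  have "poly_var i = const_poly (c i) * Z + const_poly (b i) * Y + const_poly (a i) * X"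
    "poly_var i = const_poly (a i) * X + const_poly (c i) * Z + const_poly (b i) * Y"
    "poly_var i = const_poly (b i) * Y + const_poly (a i) * X + const_poly (c i) * Z" for i
    by (simp_all add: abc add_ac)
  with assms show "spanning_linear_forms Z Y X" "spanning_linear_forms X Z Y" "spanning_linear_forms Y X Z"
    unfolding spanning_linear_forms_def by blast+
qed

lemma forms_Suc_spanning:
  assumes "spanning_linear_forms X Y Z" "f \<in> forms (Suc d)"
  obtains A B C where "A \<in> forms d" "B \<in> forms d" "C \<in> forms d" "f = X * A + Y * B + Z * C"
proof -
  obtain r where r: "\<And>i. r i \<in> forms d" "f = (\<Sum>i\<in>UNIV. poly_var i * r i)"
    using assms(2) forms_Suc_decompose by blast
  from assms(1) obtain a b c where abc:
    "\<And>i. poly_var i = const_poly (a i) * X + const_poly (b i) * Y + const_poly (c i) * Z"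
    unfolding spanning_linear_forms_def by metis
  have "f = X * (\<Sum>i\<in>UNIV. const_poly (a i) * r i) + Y * (\<Sum>i\<in>UNIV. const_poly (b i) * r i)
      + Z * (\<Sum>i\<in>UNIV. const_poly (c i) * r i)"
    by (simp add: r(2) abc sum_distrib_left sum.distrib algebra_simps)
  moreover have "(\<Sum>i\<in>UNIV. const_poly (s i) * r i) \<in> forms d" for s
    using r(1) by (intro forms_sum const_poly_mult_forms)
  ultimately show ?thesis using that by blast
qed

subsection \<open>Diagonalization of ternary quadratic forms\<close>

definition linear_form :: "real ^ 'n \<Rightarrow> 'n::finite real_mpoly" where
  "linear_form v = (\<Sum>j\<in>UNIV. const_poly (v $ j) * poly_var j)"

lemma linear_form_forms [simp]: "linear_form v \<in> forms (Suc 0)"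
  unfolding linear_form_def by (intro forms_sum const_poly_mult_forms poly_var_forms)

lemma const_poly_sum: "const_poly (sum f I) = (\<Sum>i\<in>I. const_poly (f i))"
  by (induction I rule: infinite_finite_induct) (auto simp: const_poly_add)

text \<open>Averaging the coefficients over both orders of the indices does not change the
  polynomial, since variables commute.\<close>

lemma quadratic_form_symmetric_coeffs:
  assumes "g \<in> forms 2"
  obtains b :: "'n::finite \<Rightarrow> 'n \<Rightarrow> real" where "\<And>i j. b i j = b j i"
    "g = (\<Sum>i\<in>UNIV. \<Sum>j\<in>UNIV. const_poly (b i j) * (poly_var i * poly_var j))"
proof -
  obtain r where r: "\<And>i. r i \<in> forms (Suc 0)" "g = (\<Sum>i\<in>UNIV. poly_var i * r i)"
    using assms forms_Suc_decompose[of g 1] by (metis One_nat_def Suc_1)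
  have "\<exists>s. r i = (\<Sum>j\<in>UNIV. poly_var j * const_poly (s j))" for i
  proof -
    obtain t where t: "\<And>j. t j \<in> forms 0" "r i = (\<Sum>j\<in>UNIV. poly_var j * t j)"
      using r(1) forms_Suc_decompose by blast
    have "t j = const_poly (Poly_Mapping.lookup (t j) 0)" for j
      by (rule forms_0_const[OF t(1)])
    then have "r i = (\<Sum>j\<in>UNIV. poly_var j * const_poly (Poly_Mapping.lookup (t j) 0))"
      by (simp flip: t(2))
    then show ?thesis by (intro exI[of _ "\<lambda>j. Poly_Mapping.lookup (t j) 0"])
  qed
  then obtain s where s: "\<And>i. r i = (\<Sum>j\<in>UNIV. poly_var j * const_poly (s i j))"
    by metis
  define T where "T f = (\<Sum>i\<in>UNIV. \<Sum>j\<in>UNIV. const_poly (f i j) * (poly_var i * poly_var j))"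
    for f :: "'n \<Rightarrow> 'n \<Rightarrow> real"
  have g: "g = T s" unfolding r(2) s T_def by (simp add: sum_distrib_left mult_ac)
  have swap: "T (\<lambda>i j. f j i) = T f" for f
    unfolding T_def by (subst sum.swap) (simp add: mult.commute)
  have "T (\<lambda>i j. (s i j + s j i) / 2) = const_poly (1 / 2) * (T s + T (\<lambda>i j. s j i))"
    unfolding T_def
    by (simp flip: sum.distrib distrib_right const_poly_add const_poly_mult mult.assoc add: sum_distrib_left)
  also have "\<dots> = const_poly (1 / 2) * (T s + T s)" by (simp only: swap[of s])
  also have "\<dots> = (const_poly (1 / 2) + const_poly (1 / 2)) * T s" by (simp only: distrib_left distrib_right)
  also have "const_poly (1 / 2) + const_poly (1 / 2) = (1 :: 'n real_mpoly)"
    unfolding const_poly_add[symmetric] by simp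
  finally show ?thesis
    using that[of "\<lambda>i j. (s i j + s j i) / 2"] g unfolding T_def by (simp add: add.commute)
qed

text \<open>Spectral theorem in dimension three: an eigenvector \<open>u\<close>, an eigenvector
  \<open>v\<close> on its orthogonal complement, and the cross product, which both eigenvector
  equations make \<open>B\<close>-orthogonal to \<open>u\<close> and \<open>v\<close>.\<close>

lemma symmetric_bilinear_diagonal:
  fixes B :: "real ^ 3 \<Rightarrow> real ^ 3 \<Rightarrow> real"
  assumes B: "bilinear B" and sym: "\<And>u v. B u v = B v u"
  obtains e :: "3 \<Rightarrow> real ^ 3" where "\<And>k. norm (e k) = 1" "\<And>k l. k \<noteq> l \<Longrightarrow> e k \<bullet> e l = 0"
    "\<And>k l. k \<noteq> l \<Longrightarrow> B (e k) (e l) = 0"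
proof -
  have bil: "bilinear ((\<bullet>) :: real ^ 3 \<Rightarrow> _)"
    by (simp add: bilinear_conv_bounded_bilinear bounded_bilinear_inner)
  have ker: "B u v = 0" if "u \<bullet> u = 0" for u v
    using that by (simp add: bilinear_lzero[OF B])
  have ex: "\<exists>u\<in>(UNIV :: (real ^ 3) set). u \<bullet> u \<noteq> 0"
    by (intro bexI[of _ "axis 1 1"]) (simp_all add: inner_axis_axis)
  then obtain a u where u: "u \<noteq> 0" "\<And>v. B u v = a * (u \<bullet> v)"
    using generalized_eigenvector[of B "(\<bullet>)" UNIV, OF B sym bil inner_commute subspace_UNIV inner_ge_zero ker ex]
    by (metis UNIV_I inner_zero_left)
  define S where "S = {v. orthogonal u v}"
  have S: "subspace S" unfolding S_def by (rule subspace_orthogonal_to_vector)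
  obtain w where "w \<noteq> 0" "orthogonal u w"
    using orthogonal_to_vector_exists[of u] by auto
  then have ex: "\<exists>v\<in>S. v \<bullet> v \<noteq> 0" by (intro bexI[of _ w]) (auto simp: S_def)
  then obtain b v where v: "v \<noteq> 0" "v \<in> S" "\<And>w. w \<in> S \<Longrightarrow> B v w = b * (v \<bullet> w)"
    using generalized_eigenvector[of B "(\<bullet>)" S, OF B sym bil inner_commute S inner_ge_zero ker ex]
    by (metis inner_zero_left)
  define e1 e2 where "e1 = u /\<^sub>R norm u" and "e2 = v /\<^sub>R norm v"
  define e3 where "e3 = cross3 e1 e2"
  have uv: "u \<bullet> v = 0" using v(2) by (simp add: S_def orthogonal_def)
  have norms: "norm e1 = 1" "norm e2 = 1" using u v by (simp_all add: e1_def e2_def)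
  have e12: "e1 \<bullet> e2 = 0" by (simp add: e1_def e2_def uv)
  have e13: "e1 \<bullet> e3 = 0" and e23: "e2 \<bullet> e3 = 0" by (simp_all add: e3_def dot_cross_self)
  have "(norm e3)\<^sup>2 = 1" using norm_cross[of e1 e2] by (simp add: e3_def norms e12)
  then have norm3: "norm e3 = 1"
    using norm_ge_zero[of e3] unfolding power2_eq_1_iff by linarith
  have "u \<bullet> e3 = 0" "v \<bullet> e3 = 0" using e13 e23 u(1) v(1) by (simp_all add: e1_def e2_def)
  then have B3: "B u e3 = 0" "B v e3 = 0"
    using u(2) v(3)[of e3] by (simp_all add: S_def orthogonal_def)
  have B12: "B u v = 0" using u(2) uv by simp
  have Be: "B e1 e2 = 0" "B e1 e3 = 0" "B e2 e3 = 0"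
    by (simp_all add: e1_def e2_def bilinear_lmul[OF B] bilinear_rmul[OF B] B12 B3)
  define e where "e k = (if k = 1 then e1 else if k = 2 then e2 else e3)" for k :: 3
  have e: "e 1 = e1" "e 2 = e2" "e 3 = e3" by (simp_all add: e_def)
  show ?thesis
  proof
    have "\<forall>k. norm (e k) = 1" by (simp add: forall_3 e norms norm3)
    then show "norm (e k) = 1" for k by blast
    have "\<forall>k l. k \<noteq> l \<longrightarrow> e k \<bullet> e l = 0"
      using e12 e13 e23 by (simp add: forall_3 e inner_commute)
    then show "k \<noteq> l \<Longrightarrow> e k \<bullet> e l = 0" for k l by blast
    have "\<forall>k l. k \<noteq> l \<longrightarrow> B (e k) (e l) = 0"
      using Be sym[of e2 e1] sym[of e3 e1] sym[of e3 e2] by (simp add: forall_3 e)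
    then show "k \<noteq> l \<Longrightarrow> B (e k) (e l) = 0" for k l by blast
  qed
qed

lemma sum_swap4:
  "(\<Sum>i\<in>A. \<Sum>j\<in>B. \<Sum>k\<in>C. \<Sum>l\<in>D. f i j k l) = (\<Sum>k\<in>C. \<Sum>l\<in>D. \<Sum>i\<in>A. \<Sum>j\<in>B. f i j k l)"
proof -
  have "(\<Sum>i\<in>A. \<Sum>j\<in>B. \<Sum>k\<in>C. \<Sum>l\<in>D. f i j k l) = (\<Sum>i\<in>A. \<Sum>k\<in>C. \<Sum>l\<in>D. \<Sum>j\<in>B. f i j k l)"
    by (intro sum.cong refl, subst sum.swap, intro sum.cong refl, rule sum.swap)
  also have "\<dots> = (\<Sum>k\<in>C. \<Sum>l\<in>D. \<Sum>i\<in>A. \<Sum>j\<in>B. f i j k l)"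
    by (subst sum.swap, intro sum.cong refl, rule sum.swap)
  finally show ?thesis .
qed

text \<open>Principal axes: in the linear forms \<open>X k\<close> of the axes \<open>e k\<close>,
  the form has the coefficients \<open>B (e k) (e l)\<close>, of which only the diagonal
  survives.\<close>

lemma ternary_quadratic_diagonal:
  fixes g :: "3 real_mpoly"
  assumes "g \<in> forms 2"
  obtains X Y Z \<alpha> \<beta> \<gamma> where "spanning_linear_forms X Y Z"
    "g = const_poly \<alpha> * (X * X) + const_poly \<beta> * (Y * Y) + const_poly \<gamma> * (Z * Z)"
proof -
  obtain b :: "3 \<Rightarrow> 3 \<Rightarrow> real" where b: "\<And>i j. b i j = b j i"
    "g = (\<Sum>i\<in>UNIV. \<Sum>j\<in>UNIV. const_poly (b i j) * (poly_var i * poly_var j))"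
    using quadratic_form_symmetric_coeffs[OF assms] by blast
  define B :: "real ^ 3 \<Rightarrow> real ^ 3 \<Rightarrow> real"
    where "B u v = (\<Sum>i\<in>UNIV. \<Sum>j\<in>UNIV. b i j * u $ i * v $ j)" for u v
  have "bilinear B"
    unfolding bilinear_def B_def
    by (intro conjI allI linearI) (simp_all add: algebra_simps sum.distrib sum_distrib_left)
  moreover have "B u v = B v u" for u v
    unfolding B_def by (subst sum.swap) (simp add: b(1) mult_ac)
  ultimately obtain e :: "3 \<Rightarrow> real ^ 3" where e: "\<And>k. norm (e k) = 1" "\<And>k l. k \<noteq> l \<Longrightarrow> e k \<bullet> e l = 0"
    "\<And>k l. k \<noteq> l \<Longrightarrow> B (e k) (e l) = 0"
    using symmetric_bilinear_diagonal by blast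
  define X where "X k = linear_form (e k)" for k
  \<comment> \<open>Orthonormal rows give orthonormal columns; \<open>dual\<close> states the latter
    and inverts the coordinate change.\<close>
  have "orthogonal_matrix (\<chi> k. e k)"
    by (simp add: orthogonal_matrix_orthonormal_rows row_def orthogonal_def e)
  then have "transpose (\<chi> k. e k) ** (\<chi> k. e k) = mat 1"
    by (simp add: orthogonal_matrix)
  then have dual: "(\<Sum>k\<in>UNIV. e k $ i * e k $ j) = (if i = j then 1 else 0)" for i j
    by (simp add: vec_eq_iff matrix_matrix_mult_def transpose_def mat_def)
  have var: "poly_var i = (\<Sum>k\<in>UNIV. const_poly (e k $ i) * X k)" for i
  proof -
    have "(\<Sum>k\<in>UNIV. const_poly (e k $ i) * X k)
        = (\<Sum>k\<in>UNIV. \<Sum>j\<in>UNIV. const_poly (e k $ i * e k $ j) * poly_var j)"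
      by (simp add: X_def linear_form_def sum_distrib_left const_poly_mult mult.assoc)
    also have "\<dots> = (\<Sum>j\<in>UNIV. const_poly (\<Sum>k\<in>UNIV. e k $ i * e k $ j) * poly_var j)"
      by (subst sum.swap) (simp only: const_poly_sum sum_distrib_right)
    also have "\<dots> = (\<Sum>j\<in>UNIV. if i = j then poly_var j else 0)"
      unfolding dual by (intro sum.cong) auto
    finally show ?thesis by simp
  qed
  have "poly_var i * poly_var j = (\<Sum>k\<in>UNIV. \<Sum>l\<in>UNIV. const_poly (e k $ i * e l $ j) * (X k * X l))" for i j
    unfolding var sum_product by (simp add: const_poly_mult mult_ac)
  then have "g = (\<Sum>i\<in>UNIV. \<Sum>j\<in>UNIV. \<Sum>k\<in>UNIV. \<Sum>l\<in>UNIV.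
      const_poly (b i j * e k $ i * e l $ j) * (X k * X l))"
    unfolding b(2) by (simp only: sum_distrib_left const_poly_mult mult.assoc)
  also have "\<dots> = (\<Sum>k\<in>UNIV. \<Sum>l\<in>UNIV. \<Sum>i\<in>UNIV. \<Sum>j\<in>UNIV.
      const_poly (b i j * e k $ i * e l $ j) * (X k * X l))"
    by (rule sum_swap4)
  also have "\<dots> = (\<Sum>k\<in>UNIV. \<Sum>l\<in>UNIV. const_poly (B (e k) (e l)) * (X k * X l))"
    by (simp only: B_def const_poly_sum sum_distrib_right)
  also have "\<dots> = const_poly (B (e 1) (e 1)) * (X 1 * X 1) + const_poly (B (e 2) (e 2)) * (X 2 * X 2)
      + const_poly (B (e 3) (e 3)) * (X 3 * X 3)"
    by (simp add: sum_3 e(3))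
  finally have "g = \<dots>" .
  moreover have "spanning_linear_forms (X 1) (X 2) (X 3)"
    unfolding spanning_linear_forms_def using var by (auto simp: sum_3 X_def)
  ultimately show ?thesis using that by blast
qed

subsection \<open>Common zeros of large kernels\<close>

text \<open>Either two coefficients have opposite signs or all agree weakly in sign. The orders of
  the letters match the permutations in \<open>spanning_linear_forms_perm\<close>.\<close>

lemma real_sign_cases:
  fixes a b c :: real
  assumes "a \<noteq> 0 \<or> b \<noteq> 0 \<or> c \<noteq> 0"
  shows "a * b < 0 \<or> a * c < 0 \<or> c * b < 0 \<or>
    a > 0 \<and> b \<ge> 0 \<and> c \<ge> 0 \<or> b > 0 \<and> a \<ge> 0 \<and> c \<ge> 0 \<or> c > 0 \<and> b \<ge> 0 \<and> a \<ge> 0 \<or>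
    - a > 0 \<and> - b \<ge> 0 \<and> - c \<ge> 0 \<or> - b > 0 \<and> - a \<ge> 0 \<and> - c \<ge> 0 \<or> - c > 0 \<and> - b \<ge> 0 \<and> - a \<ge> 0"
  using assms
  by (cases a "0 :: real" rule: linorder_cases; cases b "0 :: real" rule: linorder_cases;
      cases c "0 :: real" rule: linorder_cases; simp add: mult_less_0_iff)

section \<open>Kernels containing all linear multiples of a quadratic form\<close>

context psd_functional_cubics
begin

text \<open>On the conic, \<open>- Z / Y\<close> and \<open>c Y / X\<close> are the same function.
  Multiplication by it turns the cubics \<open>X A + Y B\<close>, which vanish at its pole
  \<open>X = Y = 0\<close>, into \<open>c Y A - Z B\<close>, and an eigenvector yields the zero. For
  \<open>c = 0\<close> the conic is a pair of lines, and \<open>deg\<close> excludes a case that is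
  settled by exchanging \<open>X\<close> and \<open>Z\<close>.\<close>

lemma common_zero_if_null_conic_aux:
  assumes lin3: "spanning_linear_forms X Y Z"
    and null: "\<And>A B. A \<in> forms 2 \<Longrightarrow> B \<in> forms 2 \<Longrightarrow> L ((X * Z + const_poly c * (Y * Y)) * (A * B)) = 0"
    and nontrivial: "\<not> forms 3 \<subseteq> null_forms"
    and deg: "c \<noteq> 0 \<or> (\<forall>A\<in>forms 2. X * A \<in> null_forms) \<or> (\<exists>A\<in>forms 2. Z * A \<notin> null_forms)"
  shows "\<exists>x. x \<noteq> 0 \<and> (\<forall>f\<in>null_forms. mpoly_eval f x = 0)"
proof -
  have X: "X \<in> forms 1" and Y: "Y \<in> forms 1" and Z: "Z \<in> forms 1"
    using lin3 by (auto simp: spanning_linear_forms_def)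
  note lq = linear_mult_quadratic
  show ?thesis
  proof (cases "\<forall>A\<in>forms 2. X * A \<in> null_forms \<and> Y * A \<in> null_forms")
    \<comment> \<open>No eigenvector is available when all cubics \<open>X A + Y B\<close> are null.
      Then \<open>X\<close> and \<open>Y\<close> act as zero and the pole itself is the common
      zero.\<close>
    case True
    have "\<exists>C\<in>forms 2. Z * C \<notin> null_forms"
    proof (rule ccontr)
      assume not: "\<not> ?thesis"
      have "f \<in> null_forms" if f: "f \<in> forms 3" for f
      proof -
        have "f \<in> forms (Suc 2)" using f by simp
        then obtain A B C where "A \<in> forms 2" "B \<in> forms 2" "C \<in> forms 2" "f = X * A + Y * B + Z * C"
          by (rule forms_Suc_spanning[OF lin3])
        then show ?thesis using True not by (auto intro!: null_forms_add)
      qed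
      with nontrivial show False by blast
    qed
    then obtain C where C: "C \<in> forms 2" "Z * C \<notin> null_forms" by blast
    show ?thesis
    proof (rule common_zero[where e = 2 and h = "Z * C" and w = Z and a = 0 and b = 0 and c = 1, OF _ _ C(2) lin3 Z])
      show "L (Z * C * (X * m)) = 0 * L (Z * C * (Z * m))"
        "L (Z * C * (Y * m)) = 0 * L (Z * C * (Z * m))" if m: "m \<in> forms 2" for m
        using True m null_forms_mult(2)[OF _ lq[OF Z C(1)]] by simp_all
    qed (use lq[OF Z C(1)] in simp_all)
  next
    case False
    \<comment> \<open>\<open>v e\<close> depends on the pair \<open>e\<close> and not only on the
      cubic \<open>u e\<close>; by \<open>ker\<close> the choice of the pair does not affect
      \<open>B\<close>.\<close>
    define u where "u e = X * quad (fst e) + Y * quad (snd e)" for e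
    define v where "v e = const_poly c * (Y * quad (fst e)) - Z * quad (snd e)" for e
    define Q where "Q e e' = L (u e * u e')" for e e'
    define B where "B e e' = L (v e * u e')" for e e'
    have u_forms: "u e \<in> forms 3" and v_forms: "v e \<in> forms 3" for e
      unfolding u_def v_def by (intro forms_add forms_diff const_poly_mult_forms lq X Y Z quad_forms)+
    have u_lin: "u (e + e') = u e + u e'" "u (r *\<^sub>R e) = const_poly r * u e"
      and v_lin: "v (e + e') = v e + v e'" "v (r *\<^sub>R e) = const_poly r * v e" for e e' r
      by (simp_all add: u_def v_def form_of_add form_of_scaleR algebra_simps)
    have bilQ: "bilinear Q" and bilB: "bilinear B"
      unfolding Q_def B_def by (rule bilinear_functional; rule u_lin v_lin)+
    have symQ: "Q e e' = Q e' e" for e e' by (simp add: Q_def mult.commute)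
    \<comment> \<open>The two products differ by a multiple of the conic, on which \<open>L\<close>
      vanishes.\<close>
    have symB: "B e e' = B e' e" for e e'
    proof -
      have "v e * u e' - v e' * u e
          = (X * Z + const_poly c * (Y * Y)) * (quad (fst e) * quad (snd e'))
          - (X * Z + const_poly c * (Y * Y)) * (quad (fst e') * quad (snd e))"
        by (simp add: u_def v_def algebra_simps)
      then have "L (v e * u e' - v e' * u e) = 0"
        by (simp add: L_simps null)
      then show ?thesis by (simp add: B_def L_simps)
    qed
    have nonneg: "0 \<le> Q e e" for e unfolding Q_def by (intro psd u_forms)
    have ker: "B e e' = 0" if "Q e e = 0" for e e'
    proof -
      have "u e \<in> null_forms" using that u_forms by (simp add: null_forms_iff Q_def)
      then have "B e' e = 0" unfolding B_def by (rule null_forms_mult(2)) (rule v_forms)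
      then show ?thesis using symB by simp
    qed
    have ex: "\<exists>e\<in>UNIV. Q e e \<noteq> 0"
    proof (rule ccontr)
      assume "\<not> ?thesis"
      then have "Q e e = 0" for e by blast
      then have N: "u e \<in> null_forms" for e
        unfolding null_forms_iff using u_forms by (simp only: Q_def simp_thms)
      have "X * A \<in> null_forms \<and> Y * A \<in> null_forms" if A: "A \<in> forms 2" for A
        using N[of "(coords A, 0)"] N[of "(0, coords A)"]
        by (simp add: u_def quad_coords[OF A])
      with False show False by blast
    qed
    obtain a e0 where e0: "Q e0 e0 \<noteq> 0" "\<And>e. B e0 e = a * Q e0 e" "(\<exists>e. B e e \<noteq> 0) \<longrightarrow> a \<noteq> 0"
      using generalized_eigenvector[of B Q UNIV, OF bilB symB bilQ symQ subspace_UNIV nonneg ker ex]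
      by blast
    define n0 where "n0 = u e0"
    have n0: "n0 \<in> forms 3" "n0 \<notin> null_forms"
      using u_forms e0(1) by (simp_all add: n0_def null_forms_iff Q_def)
    have eig: "L (n0 * v e) = a * L (n0 * u e)" for e
      using e0(2)[of e] symB[of e0 e] by (simp add: B_def Q_def n0_def mult.commute)
    \<comment> \<open>Pairs with one zero entry split the eigenvector equation into the action of
      the coordinates on \<open>p \<mapsto> L (n0 * p)\<close>: \<open>c Y = a X\<close> and
      \<open>Z = - a Y\<close>.\<close>
    have eigY: "c * L (n0 * (Y * m)) = a * L (n0 * (X * m))" if m: "m \<in> forms 2" for m
      using eig[of "(coords m, 0)"]
      by (simp add: u_def v_def quad_coords[OF m] L_simps mult.left_commute[of n0 "const_poly c"])
    have eigZ: "L (n0 * (Z * m)) = - a * L (n0 * (Y * m))" if m: "m \<in> forms 2" for m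
      using eig[of "(0, coords m)"]
      by (simp add: u_def v_def quad_coords[OF m] L_simps)
    have zero_c0: ?thesis if "\<And>m. m \<in> forms 2 \<Longrightarrow> L (n0 * (X * m)) = 0"
      using common_zero[where e = 2 and w = Y and a = 0 and b = 1 and c = "- a", OF _ n0 lin3 Y] that eigZ
      by simp
    show ?thesis
    proof (cases "c = 0")
      case c: False
      have act: "L (n0 * (Y * m)) = (a / c) * L (n0 * (X * m))" if "m \<in> forms 2" for m
        using eigY[OF that] c by (simp add: field_simps)
      \<comment> \<open>In the coordinates \<open>X\<close>, \<open>Y\<close>, \<open>Z\<close> the
        zero is the point \<open>(1, a / c, - a\<^sup>2 / c)\<close> of the conic.\<close>
      show ?thesis
        using common_zero[where e = 2 and w = X and a = 1 and b = "a / c" and c = "- a * (a / c)", OF _ n0 lin3 X]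
          act eigZ by simp
    next
      case c: True
      \<comment> \<open>In the first two cases \<open>X\<close> acts as zero and the common zero is
        \<open>(0, 1, - a)\<close>. In the third case the diagonal of \<open>B\<close> vanishes,
        hence \<open>B\<close> by polarization; then \<open>X\<close> and \<open>Y\<close> act as
        zero on \<open>p \<mapsto> L (Z * C * p)\<close> and the common zero is
        \<open>(0, 0, 1)\<close>.\<close>
      consider "\<forall>A\<in>forms 2. X * A \<in> null_forms" | "a \<noteq> 0"
        | C where "\<forall>e. B e e = 0" "C \<in> forms 2" "Z * C \<notin> null_forms" using e0(3) deg c by blast
      then show ?thesis
      proof cases
        case 1
        then show ?thesis using null_forms_mult(2)[OF _ n0(1)] by (intro zero_c0) blast
      next
        case 2
        then show ?thesis using eigY c by (intro zero_c0) simp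
      next
        case 3
        have B0: "B e e' = 0" for e e'
        proof -
          have "0 = B (e + e') (e + e')" by (rule 3(1)[rule_format, symmetric])
          also have "\<dots> = 2 * B e e'"
            using 3(1)[rule_format, of e] 3(1)[rule_format, of e'] symB[of e' e] by (simp add: bilinear_ladd[OF bilB] bilinear_radd[OF bilB])
          finally show ?thesis by simp
        qed
        show ?thesis
        proof (rule common_zero[where e = 2 and h = "Z * C" and w = Z and a = 0 and b = 0 and c = 1, OF _ _ 3(3) lin3 Z])
          fix m :: "3 real_mpoly" assume m: "m \<in> forms 2"
          show "L (Z * C * (X * m)) = 0 * L (Z * C * (Z * m))"
            using null[OF 3(2) m] c by (simp add: mult_ac)
          show "L (Z * C * (Y * m)) = 0 * L (Z * C * (Z * m))"
            using B0[of "(0, coords C)" "(0, coords m)"]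
            by (simp add: B_def u_def v_def quad_coords m 3(2) L_simps)
        qed (use lq[OF Z 3(2)] in simp_all)
      qed
    qed
  qed
qed

text \<open>If \<open>c = 0\<close> and all multiples of \<open>Z\<close> are null, then
  \<open>X\<close> and \<open>Z\<close> are exchanged: the line with null multiples comes first, as
  \<open>deg\<close> allows.\<close>

lemma common_zero_if_null_conic:
  assumes lin3: "spanning_linear_forms X Y Z"
    and null: "\<And>A B. A \<in> forms 2 \<Longrightarrow> B \<in> forms 2 \<Longrightarrow> L ((X * Z + const_poly c * (Y * Y)) * (A * B)) = 0"
    and nontrivial: "\<not> forms 3 \<subseteq> null_forms"
  shows "\<exists>x. x \<noteq> 0 \<and> (\<forall>f\<in>null_forms. mpoly_eval f x = 0)"
proof (cases "c = 0 \<and> (\<forall>A\<in>forms 2. Z * A \<in> null_forms)")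
  case True
  show ?thesis
  proof (rule common_zero_if_null_conic_aux[OF spanning_linear_forms_perm(1)[OF lin3] _ nontrivial, where c = 0])
    show "L ((Z * X + const_poly 0 * (Y * Y)) * (A * B)) = 0" if "A \<in> forms 2" "B \<in> forms 2" for A B
      using null[OF that] True by (simp add: mult.commute[of Z X])
  qed (use True in blast)
next
  case False
  then have "c \<noteq> 0 \<or> (\<forall>A\<in>forms 2. X * A \<in> null_forms) \<or> (\<exists>A\<in>forms 2. Z * A \<notin> null_forms)"
    by blast
  from common_zero_if_null_conic_aux[OF lin3 null nontrivial this] show ?thesis .
qed

text \<open>The pair of lines \<open>X Z = 0\<close> serves as the null conic.\<close>

lemma common_zero_if_null_double_line:
  assumes lin3: "spanning_linear_forms X Y Z"
    and null: "\<And>A. A \<in> forms 2 \<Longrightarrow> X * A \<in> null_forms"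
    and nontrivial: "\<not> forms 3 \<subseteq> null_forms"
  shows "\<exists>x. x \<noteq> 0 \<and> (\<forall>f\<in>null_forms. mpoly_eval f x = 0)"
proof (rule common_zero_if_null_conic[OF lin3 _ nontrivial, where c = 0])
  fix A B :: "3 real_mpoly" assume A: "A \<in> forms 2" and B: "B \<in> forms 2"
  have "Z \<in> forms 1" using lin3 by (simp add: spanning_linear_forms_def)
  from null_forms_mult(1)[OF null[OF A] linear_mult_quadratic[OF this B]]
  show "L ((X * Z + const_poly 0 * (Y * Y)) * (A * B)) = 0" by (simp add: mult_ac)
qed

text \<open>Opposite signs let the first two terms factor over the reals as
  \<open>\<alpha> S T\<close> with \<open>S = X - p Y\<close> and \<open>T = X + p Y\<close>. In the
  coordinates \<open>S\<close>, \<open>Z\<close>, \<open>T\<close> this is a null conic with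
  constant \<open>\<gamma> / \<alpha>\<close>.\<close>

lemma common_zero_if_indefinite:
  assumes lin3: "spanning_linear_forms X Y Z" and signs: "\<alpha> * \<beta> < 0"
    and null: "\<And>A B. A \<in> forms 2 \<Longrightarrow> B \<in> forms 2 \<Longrightarrow>
      L ((const_poly \<alpha> * (X * X) + const_poly \<beta> * (Y * Y) + const_poly \<gamma> * (Z * Z)) * (A * B)) = 0"
    and nontrivial: "\<not> forms 3 \<subseteq> null_forms"
  shows "\<exists>x. x \<noteq> 0 \<and> (\<forall>f\<in>null_forms. mpoly_eval f x = 0)"
proof -
  define p where "p = sqrt (- (\<beta> / \<alpha>))"
  have \<alpha>: "\<alpha> \<noteq> 0" using signs by auto
  have "\<beta> / \<alpha> < 0" using signs by (simp add: mult_less_0_iff divide_less_0_iff) linarith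
  then have "0 < - (\<beta> / \<alpha>)" by linarith
  then have p: "p > 0" "p * p = - (\<beta> / \<alpha>)"
    unfolding p_def real_sqrt_mult_self by (simp, rule abs_of_pos)
  define S T where "S = X - const_poly p * Y" and "T = X + const_poly p * Y"
  have "spanning_linear_forms S Z T"
  proof -
    from lin3 obtain a b c where abc:
      "\<And>i. poly_var i = const_poly (a i) * X + const_poly (b i) * Y + const_poly (c i) * Z"
      unfolding spanning_linear_forms_def by metis
    have half: "const_poly (1 / 2) + const_poly (1 / 2) = (1 :: 3 real_mpoly)"
      unfolding const_poly_add[symmetric] by simp
    have "const_poly (1 / 2) * S + const_poly (1 / 2) * T = (const_poly (1 / 2) + const_poly (1 / 2)) * X"
      by (simp add: S_def T_def algebra_simps)
    then have X: "X = const_poly (1 / 2) * S + const_poly (1 / 2) * T" by (simp add: half)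
    have "const_poly (- (1 / 2)) * S + const_poly (1 / 2) * T
        = (const_poly (1 / 2) + const_poly (1 / 2)) * (const_poly p * Y)"
      by (simp add: S_def T_def const_poly_uminus algebra_simps)
    then have pY: "const_poly p * Y = const_poly (- (1 / 2)) * S + const_poly (1 / 2) * T" by (simp add: half)
    have "Y = const_poly (1 / p) * (const_poly p * Y)"
      using p(1) by (simp flip: mult.assoc const_poly_mult)
    moreover have "1 / p * - (1 / 2) = - (1 / (2 * p))" "1 / p * (1 / 2) = 1 / (2 * p)" by simp_all
    ultimately have Y: "Y = const_poly (- (1 / (2 * p))) * S + const_poly (1 / (2 * p)) * T"
      by (simp only: pY distrib_left mult.assoc[symmetric] const_poly_mult[symmetric])
    have "poly_var i = const_poly (a i / 2 - b i / (2 * p)) * S + const_poly (c i) * Z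
        + const_poly (a i / 2 + b i / (2 * p)) * T" for i
    proof -
      have "poly_var i = const_poly (a i) * (const_poly (1 / 2) * S + const_poly (1 / 2) * T)
          + const_poly (b i) * (const_poly (- (1 / (2 * p))) * S + const_poly (1 / (2 * p)) * T)
          + const_poly (c i) * Z"
        using abc[of i] by (simp only: X[symmetric] Y[symmetric])
      also have "\<dots> = (const_poly (a i * (1 / 2)) + const_poly (b i * - (1 / (2 * p)))) * S
          + const_poly (c i) * Z + (const_poly (a i * (1 / 2)) + const_poly (b i * (1 / (2 * p)))) * T"
        unfolding const_poly_mult by (simp add: algebra_simps)
      finally show ?thesis by (simp flip: const_poly_add)
    qed
    moreover have "S \<in> forms 1" "T \<in> forms 1" "Z \<in> forms 1"
      using lin3 by (auto simp: S_def T_def spanning_linear_forms_def)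
    ultimately show ?thesis unfolding spanning_linear_forms_def by blast
  qed
  then show ?thesis
  proof (rule common_zero_if_null_conic[OF _ _ nontrivial, where c = "\<gamma> / \<alpha>"])
    fix A B :: "3 real_mpoly" assume AB: "A \<in> forms 2" "B \<in> forms 2"
    have "S * T = X * X - const_poly (p * p) * (Y * Y)"
      by (simp add: S_def T_def const_poly_mult algebra_simps)
    also have "\<dots> = X * X + const_poly (\<beta> / \<alpha>) * (Y * Y)"
      by (simp add: p(2) const_poly_uminus)
    finally have ST: "S * T = \<dots>" .
    have "const_poly \<beta> = const_poly \<alpha> * (const_poly (\<beta> / \<alpha>) :: 3 real_mpoly)"
      "const_poly \<gamma> = const_poly \<alpha> * (const_poly (\<gamma> / \<alpha>) :: 3 real_mpoly)"
      unfolding const_poly_mult[symmetric] using \<alpha> by simp_all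
    then have "const_poly \<alpha> * ((S * T + const_poly (\<gamma> / \<alpha>) * (Z * Z)) * (A * B))
        = (const_poly \<alpha> * (X * X) + const_poly \<beta> * (Y * Y) + const_poly \<gamma> * (Z * Z)) * (A * B)"
      unfolding ST by (simp only: distrib_left distrib_right mult_ac)
    then have "\<alpha> * L ((S * T + const_poly (\<gamma> / \<alpha>) * (Z * Z)) * (A * B)) = 0"
      using null[OF AB] by (simp only: L_simps(2)[symmetric])
    then show "L ((S * T + const_poly (\<gamma> / \<alpha>) * (Z * Z)) * (A * B)) = 0" using \<alpha> by simp
  qed
qed

text \<open>On the multiple of the quadratic form by \<open>A\<^sup>2\<close>, \<open>L\<close> is a
  sum of nonnegative terms, so each term is zero; as \<open>\<alpha>\<close> is positive, all
  multiples of \<open>X\<close> are null.\<close>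

lemma common_zero_if_semidefinite:
  assumes lin3: "spanning_linear_forms X Y Z" and signs: "\<alpha> > 0" "\<beta> \<ge> 0" "\<gamma> \<ge> 0"
    and null: "\<And>A. A \<in> forms 2 \<Longrightarrow>
      L ((const_poly \<alpha> * (X * X) + const_poly \<beta> * (Y * Y) + const_poly \<gamma> * (Z * Z)) * (A * A)) = 0"
    and nontrivial: "\<not> forms 3 \<subseteq> null_forms"
  shows "\<exists>x. x \<noteq> 0 \<and> (\<forall>f\<in>null_forms. mpoly_eval f x = 0)"
proof (rule common_zero_if_null_double_line[OF lin3 _ nontrivial])
  fix A :: "3 real_mpoly" assume A: "A \<in> forms 2"
  have XYZ: "X * A \<in> forms 3" "Y * A \<in> forms 3" "Z * A \<in> forms 3"
    using lin3 by (auto simp: spanning_linear_forms_def intro: linear_mult_quadratic A)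
  have "(const_poly \<alpha> * (X * X) + const_poly \<beta> * (Y * Y) + const_poly \<gamma> * (Z * Z)) * (A * A)
      = const_poly \<alpha> * (X * A * (X * A)) + const_poly \<beta> * (Y * A * (Y * A)) + const_poly \<gamma> * (Z * A * (Z * A))"
    by (simp add: algebra_simps)
  then have "\<alpha> * L (X * A * (X * A)) + \<beta> * L (Y * A * (Y * A)) + \<gamma> * L (Z * A * (Z * A)) = 0"
    using null[OF A] by (simp only: L_simps)
  moreover have "0 \<le> \<alpha> * L (X * A * (X * A))" "0 \<le> \<beta> * L (Y * A * (Y * A))" "0 \<le> \<gamma> * L (Z * A * (Z * A))"
    using signs XYZ psd by simp_all
  ultimately have "\<alpha> * L (X * A * (X * A)) = 0" by linarith
  then show "X * A \<in> null_forms" using signs XYZ by (simp add: null_forms_iff)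
qed

lemma common_zero_if_null_quadric:
  assumes g: "g \<in> forms 2" "g \<noteq> 0" and null: "\<And>i. poly_var i * g \<in> null_forms"
    and nontrivial: "\<not> forms 3 \<subseteq> null_forms"
  shows "\<exists>x. x \<noteq> 0 \<and> (\<forall>f\<in>null_forms. mpoly_eval f x = 0)"
proof -
  \<comment> \<open>A factor \<open>poly_var i\<close> of \<open>A\<close> is shifted to
    \<open>g\<close>, which leaves products of a null cubic and a cubic.\<close>
  have nullAB: "L (g * (A * B)) = 0" if A: "A \<in> forms 2" and B: "B \<in> forms 2" for A B
  proof -
    obtain r where r: "\<And>i. r i \<in> forms 1" "A = (\<Sum>i\<in>UNIV. poly_var i * r i)"
      using forms_Suc_decompose[of A 1] A by (auto simp: numeral_2_eq_2)
    have "g * (A * B) = (\<Sum>i\<in>UNIV. poly_var i * g * (r i * B))"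
      by (simp add: r(2) sum_distrib_left sum_distrib_right mult_ac)
    then show ?thesis
      using null_forms_mult(1)[OF null linear_mult_quadratic[OF r(1) B]]
      by (simp add: poly_linear_sum[OF lin])
  qed
  obtain X Y Z \<alpha> \<beta> \<gamma> where lin3: "spanning_linear_forms X Y Z"
    and g_eq: "g = const_poly \<alpha> * (X * X) + const_poly \<beta> * (Y * Y) + const_poly \<gamma> * (Z * Z)"
    by (rule ternary_quadratic_diagonal[OF g(1)])
  note perm = spanning_linear_forms_perm
  have g_eqs: "g = const_poly \<alpha> * (X * X) + const_poly \<gamma> * (Z * Z) + const_poly \<beta> * (Y * Y)"
    "g = const_poly \<gamma> * (Z * Z) + const_poly \<beta> * (Y * Y) + const_poly \<alpha> * (X * X)"
    "g = const_poly \<beta> * (Y * Y) + const_poly \<alpha> * (X * X) + const_poly \<gamma> * (Z * Z)"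
    by (simp_all add: g_eq add_ac)
  have nullAA: "L (g * (A * A)) = 0" if "A \<in> forms 2" for A
    by (rule nullAB[OF that that])
  \<comment> \<open>The negative semidefinite cases are the positive ones for
    \<open>- g\<close>.\<close>
  have neg: "L ((const_poly (- a) * A + const_poly (- b) * B + const_poly (- c) * C) * (D * D)) = 0"
    if "g = const_poly a * A + const_poly b * B + const_poly c * C" "D \<in> forms 2" for a b c A B C D
  proof -
    have "(const_poly (- a) * A + const_poly (- b) * B + const_poly (- c) * C) * (D * D) = - (g * (D * D))"
      unfolding that(1) by (simp add: const_poly_uminus algebra_simps)
    then show ?thesis using nullAB[OF that(2) that(2)] by (simp add: L_simps)
  qed
  have "\<alpha> \<noteq> 0 \<or> \<beta> \<noteq> 0 \<or> \<gamma> \<noteq> 0" using g(2) g_eq by auto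
  then consider "\<alpha> * \<beta> < 0" | "\<alpha> * \<gamma> < 0" | "\<gamma> * \<beta> < 0"
    | "\<alpha> > 0" "\<beta> \<ge> 0" "\<gamma> \<ge> 0" | "\<beta> > 0" "\<alpha> \<ge> 0" "\<gamma> \<ge> 0" | "\<gamma> > 0" "\<beta> \<ge> 0" "\<alpha> \<ge> 0"
    | "- \<alpha> > 0" "- \<beta> \<ge> 0" "- \<gamma> \<ge> 0" | "- \<beta> > 0" "- \<alpha> \<ge> 0" "- \<gamma> \<ge> 0" | "- \<gamma> > 0" "- \<beta> \<ge> 0" "- \<alpha> \<ge> 0"
    using real_sign_cases[of \<alpha> \<beta> \<gamma>] by blast
  then show ?thesis
  proof cases
    case 1
    then show ?thesis
      by (rule common_zero_if_indefinite[OF lin3 _ nullAB[unfolded g_eq] nontrivial])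
  next
    case 2
    then show ?thesis
      by (rule common_zero_if_indefinite[OF perm(2)[OF lin3] _ nullAB[unfolded g_eqs(1)] nontrivial])
  next
    case 3
    then show ?thesis
      by (rule common_zero_if_indefinite[OF perm(1)[OF lin3] _ nullAB[unfolded g_eqs(2)] nontrivial])
  next
    case 4
    then show ?thesis
      by (rule common_zero_if_semidefinite[OF lin3 _ _ _ nullAA[unfolded g_eq] nontrivial])
  next
    case 5
    then show ?thesis
      by (rule common_zero_if_semidefinite[OF perm(3)[OF lin3] _ _ _ nullAA[unfolded g_eqs(3)] nontrivial])
  next
    case 6
    then show ?thesis
      by (rule common_zero_if_semidefinite[OF perm(1)[OF lin3] _ _ _ nullAA[unfolded g_eqs(2)] nontrivial])
  next
    case 7
    then show ?thesis
      by (rule common_zero_if_semidefinite[OF lin3 _ _ _ neg[OF g_eq] nontrivial])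
  next
    case 8
    then show ?thesis
      by (rule common_zero_if_semidefinite[OF perm(3)[OF lin3] _ _ _ neg[OF g_eqs(3)] nontrivial])
  next
    case 9
    then show ?thesis
      by (rule common_zero_if_semidefinite[OF perm(1)[OF lin3] _ _ _ neg[OF g_eqs(2)] nontrivial])
  qed
qed

section \<open>Kernels of dimension at least four\<close>

lemma spanning_linear_forms_vars:
  "spanning_linear_forms (poly_var 1 + const_poly s * poly_var 2 + const_poly t * poly_var 3)
    (poly_var 2) (poly_var 3 :: 3 real_mpoly)"
proof -
  let ?l = "poly_var 1 + const_poly s * poly_var 2 + const_poly t * poly_var 3 :: 3 real_mpoly"
  have "\<forall>i. \<exists>a b c. poly_var i = const_poly a * ?l + const_poly b * poly_var 2 + const_poly c * poly_var 3"
    unfolding forall_3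
  proof (intro conjI)
    show "\<exists>a b c. poly_var 1 = const_poly a * ?l + const_poly b * poly_var 2 + const_poly c * poly_var 3"
      by (rule exI[of _ 1], rule exI[of _ "- s"], rule exI[of _ "- t"])
        (simp add: const_poly_uminus algebra_simps)
    show "\<exists>a b c. poly_var 2 = const_poly a * ?l + const_poly b * poly_var 2 + const_poly c * poly_var 3"
      by (rule exI[of _ 0], rule exI[of _ 1], rule exI[of _ 0]) simp
    show "\<exists>a b c. poly_var 3 = const_poly a * ?l + const_poly b * poly_var 2 + const_poly c * poly_var 3"
      by (rule exI[of _ 0], rule exI[of _ 0], rule exI[of _ 1]) simp
  qed
  then show ?thesis by (simp add: spanning_linear_forms_def forms_add const_poly_mult_forms)
qed

text \<open>Dimension count 6 + 4 = 10: the multiples of \<open>l\<close> and the span of the four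
  null cubics meet only in zero, so together they fill the space of cubics.\<close>

lemma flat_if_corank_4:
  fixes q :: "4 \<Rightarrow> 3 real_mpoly"
  assumes l: "l \<in> forms 1" and q: "\<And>i. q i \<in> null_forms"
    and indep: "\<And>c :: real ^ 4. (\<Sum>i\<in>UNIV. const_poly (c $ i) * q i) = 0 \<Longrightarrow> c = 0"
    and inj: "\<And>g. g \<in> forms 2 \<Longrightarrow> l * g \<in> null_forms \<Longrightarrow> g = 0"
    and f: "f \<in> forms 3"
  shows "\<exists>g\<in>forms 2. f - l * g \<in> null_forms"
proof -
  define comb where "comb c = (\<Sum>i\<in>UNIV. const_poly (c $ i) * q i)" for c :: "real ^ 4"
  have comb: "comb c \<in> null_forms" for c
    unfolding comb_def by (intro null_forms_sum null_forms_const_mult q)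
  define \<Phi> :: "(real ^ (3, 2) mono) \<times> (real ^ 4) \<Rightarrow> real ^ (3, 3) mono"
    where "\<Phi> v = coords (l * quad (fst v) + comb (snd v))" for v
  have forms: "l * quad (fst v) + comb (snd v) \<in> forms 3" for v
    using comb null_forms_subset by (intro forms_add linear_mult_quadratic l quad_forms) blast
  have "linear \<Phi>"
    by (rule linearI) (simp_all add: \<Phi>_def comb_def form_of_add form_of_scaleR const_poly_add
        const_poly_mult sum.distrib sum_distrib_left coords_add[symmetric] coords_const_mult[symmetric] algebra_simps)
  moreover have "inj \<Phi>"
    unfolding linear_injective_0[OF \<open>linear \<Phi>\<close>]
  proof (intro allI impI)
    fix v assume "\<Phi> v = 0"
    then have "form_of (\<Phi> v) = 0" by simp
    then have eq: "l * quad (fst v) + comb (snd v) = 0"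
      unfolding \<Phi>_def using form_of_coords[of "l * quad (fst v) + comb (snd v)", where 'd = 3] forms by simp
    then have "l * quad (fst v) = const_poly (- 1) * comb (snd v)"
      by (simp add: const_poly_uminus add_eq_0_iff2)
    then have "l * quad (fst v) \<in> null_forms" using comb null_forms_const_mult by simp
    then have "quad (fst v) = 0" by (intro inj quad_forms)
    with eq have "fst v = 0" "comb (snd v) = 0" by simp_all
    moreover from this(2) have "snd v = 0" unfolding comb_def by (rule indep)
    ultimately show "v = 0" by (simp add: prod_eq_iff)
  qed
  ultimately have "dim (range \<Phi>) = DIM((real ^ (3, 2) mono) \<times> (real ^ 4))"
    using dim_image_eq[of \<Phi> UNIV] by (simp add: inj_on_def)
  also have "\<dots> = DIM(real ^ (3, 3) mono)"
    by (simp add: card_mono3 numeral_2_eq_2 numeral_3_eq_3)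
  finally have "span (range \<Phi>) = UNIV" unfolding dim_eq_full .
  moreover have "subspace (range \<Phi>)" using \<open>linear \<Phi>\<close> by (simp add: linear_subspace_image)
  ultimately have "coords f \<in> range \<Phi>" by (metis UNIV_I span_eq_iff)
  then obtain v where "coords f = \<Phi> v" by blast
  then have "form_of (coords f :: real ^ (3, 3) mono)
      = form_of (coords (l * quad (fst v) + comb (snd v)) :: real ^ (3, 3) mono)"
    by (simp add: \<Phi>_def)
  then have "f = l * quad (fst v) + comb (snd v)"
    using f forms by (simp add: form_of_coords)
  then show ?thesis using comb by (intro bexI[of _ "quad (fst v)"]) simp_all
qed

theorem common_zero_if_corank_4:
  fixes q :: "4 \<Rightarrow> 3 real_mpoly"
  assumes q: "\<And>i. q i \<in> null_forms"
    and indep: "\<And>c :: real ^ 4. (\<Sum>i\<in>UNIV. const_poly (c $ i) * q i) = 0 \<Longrightarrow> c = 0"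
    and nontrivial: "\<not> forms 3 \<subseteq> null_forms"
  shows "\<exists>x. x \<noteq> 0 \<and> (\<forall>f\<in>null_forms. mpoly_eval f x = 0)"
proof -
  let ?l = "\<lambda>s t. poly_var 1 + const_poly s * poly_var 2 + const_poly t * poly_var 3 :: 3 real_mpoly"
  show ?thesis
  \<comment> \<open>Only linear forms with coefficient 1 at the first variable are tested; if all of
    them fail, \<open>null_conic_if_all_degenerate\<close> applies to this two-parameter
    family.\<close>
  proof (cases "\<exists>s t. \<forall>g\<in>forms 2. ?l s t * g \<in> null_forms \<longrightarrow> g = 0")
    case True
    then obtain s t where inj: "\<And>g. g \<in> forms 2 \<Longrightarrow> ?l s t * g \<in> null_forms \<Longrightarrow> g = 0" by blast
    show ?thesis
    proof (rule common_zero_if_flat[OF spanning_linear_forms_vars inj])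
      fix g :: "3 real_mpoly" assume g: "g \<in> forms 2"
      show "\<exists>g'\<in>forms 2. poly_var 3 * g - ?l s t * g' \<in> null_forms"
        by (rule flat_if_corank_4[OF _ q indep inj])
          (simp_all add: forms_add const_poly_mult_forms linear_mult_quadratic g)
    qed
  next
    case False
    have "\<exists>g\<in>forms 2. g \<noteq> 0 \<and> poly_var 1 * g \<in> null_forms \<and> poly_var 2 * g \<in> null_forms \<and> poly_var 3 * g \<in> null_forms"
      by (rule null_conic_if_all_degenerate) (use False in auto)
    then obtain g where g: "g \<in> forms 2" "g \<noteq> 0" "\<forall>i. poly_var i * g \<in> null_forms"
      unfolding forall_3 by blast
    then show ?thesis by (intro common_zero_if_null_quadric[OF g(1,2) _ nontrivial]) blast
  qed
qed

end

subsection \<open>Odd maps from the sphere to the plane\<close>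

text \<open>Without zeros, \<open>F\<close> has a continuous logarithm \<open>l\<close> on the upper
  hemisphere. On the equator \<open>l (- z) - l z\<close> is odd with exponential
  \<open>- 1\<close>; its values are discrete, so it is constant, hence zero, a
  contradiction.\<close>

lemma odd_map_has_zero:
  fixes F :: "real ^ 3 \<Rightarrow> complex"
  assumes cont: "continuous_on UNIV F" and odd: "\<And>x. F (- x) = - F x"
  shows "\<exists>x. x \<noteq> 0 \<and> F x = 0"
proof (rule ccontr)
  assume "\<not> ?thesis"
  then have nz: "F x \<noteq> 0" if "x \<noteq> 0" for x using that by blast
  \<comment> \<open>For \<open>z\<close> in the unit disk, \<open>v z\<close> is the point of the
    upper hemisphere above \<open>z\<close>. On the unit circle the third coordinate is zero, so
    \<open>v\<close> is odd there.\<close>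
  define v :: "complex \<Rightarrow> real ^ 3" where
    "v z = (\<chi> i. if i = 1 then Re z else if i = 2 then Im z else sqrt (1 - (cmod z)\<^sup>2))" for z
  have v: "v z $ 1 = Re z" "v z $ 2 = Im z" "v z $ 3 = sqrt (1 - (cmod z)\<^sup>2)" for z
    by (simp_all add: v_def)
  have v_nz: "v z \<noteq> 0" for z
  proof
    assume "v z = 0"
    with v[of z] have "Re z = 0" "Im z = 0" "sqrt (1 - (cmod z)\<^sup>2) = 0" by simp_all
    moreover from this have "z = 0" by (simp add: complex_eq_iff)
    ultimately show False by simp
  qed
  have v_cont: "continuous_on S v" for S
    unfolding v_def
  proof (intro continuous_on_vec_lambda)
    fix i :: 3
    show "continuous_on S (\<lambda>z. if i = 1 then Re z else if i = 2 then Im z else sqrt (1 - (cmod z)\<^sup>2))"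
      by (cases "i = 1"; cases "i = 2"; simp; intro continuous_intros)
  qed
  have v_odd: "v (- z) = - v z" if "z \<in> sphere 0 1" for z
    using that by (simp add: vec_eq_iff forall_3 v)
  have "continuous_on (cball 0 1) (\<lambda>z. F (v z))"
    by (rule continuous_on_compose2[OF cont v_cont]) simp
  then obtain l where l: "continuous_on (cball 0 1) l" "\<And>z. z \<in> cball 0 1 \<Longrightarrow> F (v z) = exp (l z)"
    using continuous_logarithm_on_cball[of 0 1 "\<lambda>z. F (v z)"] nz v_nz by blast
  define \<phi> where "\<phi> z = l (- z) - l z" for z
  have exp_\<phi>: "exp (\<phi> z) = - 1" if z: "z \<in> sphere 0 1" for z
  proof -
    have "z \<in> cball 0 1" "- z \<in> cball 0 1" using z by auto
    then have "exp (l (- z)) = F (v (- z))" "exp (l z) = F (v z)" using l(2) by simp_all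
    moreover have "F (v (- z)) = - F (v z)" unfolding v_odd[OF z] by (rule odd)
    ultimately have "exp (l (- z)) = - exp (l z)" by simp
    then show ?thesis by (simp add: \<phi>_def exp_diff)
  qed
  have "\<phi> constant_on sphere 0 1"
  proof (rule continuous_discrete_range_constant)
    show "connected (sphere (0 :: complex) 1)" by (rule connected_sphere) simp
    show "continuous_on (sphere 0 1) \<phi>"
    proof -
      have "continuous_on (sphere 0 1) (\<lambda>z. l (- z))"
        by (rule continuous_on_compose2[OF l(1)]) (auto intro!: continuous_intros)
      moreover have "continuous_on (sphere 0 1) l"
        by (rule continuous_on_subset[OF l(1)]) auto
      ultimately show ?thesis unfolding \<phi>_def by (rule continuous_on_diff)
    qed
    fix x assume x: "x \<in> sphere (0 :: complex) 1"
    show "\<exists>e>0. \<forall>y. y \<in> sphere 0 1 \<and> \<phi> y \<noteq> \<phi> x \<longrightarrow> e \<le> norm (\<phi> y - \<phi> x)"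
    proof (intro exI[of _ "2 * pi"] conjI allI impI)
      \<comment> \<open>Values with equal exponentials differ by integer multiples of
        \<open>2 * pi * \<i>\<close>.\<close>
      fix y assume y: "y \<in> sphere 0 1 \<and> \<phi> y \<noteq> \<phi> x"
      then have "exp (\<phi> y) = exp (\<phi> x)" using exp_\<phi> x by simp
      then obtain n :: int where n: "\<phi> y = \<phi> x + (of_int (2 * n) * pi) * \<i>"
        unfolding exp_eq by blast
      then have "n \<noteq> 0" using y by auto
      then have "1 \<le> \<bar>real_of_int n\<bar>" by linarith
      then have "2 * pi * 1 \<le> 2 * pi * \<bar>real_of_int n\<bar>" by (intro mult_left_mono) auto
      also have "\<dots> = norm (\<phi> y - \<phi> x)" using n by (simp add: norm_mult)
      finally show "2 * pi \<le> norm (\<phi> y - \<phi> x)" by simp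
    qed simp
  qed
  then obtain c where c: "\<And>z. z \<in> sphere 0 1 \<Longrightarrow> \<phi> z = c" unfolding constant_on_def by blast
  have "\<phi> 1 = c" "\<phi> (- 1) = c" by (simp_all add: c)
  moreover have "\<phi> (- 1) = - \<phi> 1" by (simp add: \<phi>_def)
  ultimately have "\<phi> 1 = 0" by simp
  with exp_\<phi>[of 1] show False by simp
qed

lemma ternary_cubics_common_zero:
  fixes f g :: "3 real_mpoly"
  assumes "f \<in> forms 3" "g \<in> forms 3"
  shows "\<exists>x. x \<noteq> 0 \<and> mpoly_eval f x = 0 \<and> mpoly_eval g x = 0"
proof -
  have "\<exists>x. x \<noteq> 0 \<and> Complex (mpoly_eval f x) (mpoly_eval g x) = 0"
  proof (rule odd_map_has_zero)
    show "continuous_on UNIV (\<lambda>x. Complex (mpoly_eval f x) (mpoly_eval g x))"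
      by (intro continuous_on_Complex continuous_on_mpoly_eval)
    show "Complex (mpoly_eval f (- x)) (mpoly_eval g (- x)) = - Complex (mpoly_eval f x) (mpoly_eval g x)" for x
      by (simp add: mpoly_eval_uminus_arg[OF assms(1)] mpoly_eval_uminus_arg[OF assms(2)] complex_eq_iff)
  qed
  then show ?thesis by (simp add: complex_eq_iff)
qed

subsection \<open>Sums of squares\<close>

lemma sum_of_form_squaresE:
  assumes "sum_of_form_squares k d p"
  obtains q where "\<forall>i<k. q i \<in> forms d" "p = (\<Sum>i<k. (q i)\<^sup>2)"
  using assms unfolding sum_of_form_squares_def by (elim exE conjE)

lemma sum_of_form_squares_indexed:
  assumes "finite I" "\<And>i. i \<in> I \<Longrightarrow> q i \<in> forms d"
  shows "sum_of_form_squares (card I) d (\<Sum>i\<in>I. (q i)\<^sup>2)"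
proof -
  obtain h where h: "bij_betw h {..<card I} I"
    using ex_bij_betw_nat_finite[OF assms(1)] unfolding atLeast0LessThan by blast
  have "(\<Sum>i\<in>I. (q i)\<^sup>2) = (\<Sum>i<card I. (q (h i))\<^sup>2)"
    using sum.reindex_bij_betw[OF h, of "\<lambda>i. (q i)\<^sup>2"] by simp
  moreover have "q (h i) \<in> forms d" if "i < card I" for i
    by (rule assms(2)) (use bij_betwE[OF h] that in simp)
  ultimately show ?thesis
    unfolding sum_of_form_squares_def by (intro exI[of _ "\<lambda>i. q (h i)"]) simp
qed

lemma sum_of_form_squares_mono:
  assumes "sum_of_form_squares k d p" "k \<le> m"
  shows "sum_of_form_squares m d p"
proof -
  obtain q where q: "\<forall>i<k. q i \<in> forms d" "p = (\<Sum>i<k. (q i)\<^sup>2)"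
    using assms(1) unfolding sum_of_form_squares_def by blast
  have "(\<Sum>i<m. (if i < k then q i else 0)\<^sup>2) = (\<Sum>i<k. (if i < k then q i else 0)\<^sup>2)"
    using assms(2) by (intro sum.mono_neutral_right) auto
  also have "\<dots> = p" unfolding q(2) by (intro sum.cong) auto
  finally show ?thesis
    unfolding sum_of_form_squares_def using q(1)
    by (intro exI[of _ "\<lambda>i. if i < k then q i else 0"]) auto
qed

text \<open>The square of \<open>s = \<Sum> b\<^sub>i q\<^sub>i\<close> is absorbed by replacing \<open>q\<^sub>i\<close> with \<open>q\<^sub>i + \<beta> b\<^sub>i s\<close>, where
  \<open>2 \<beta> + \<beta>\<^sup>2 \<Sum> b\<^sub>i\<^sup>2 = 1\<close>.\<close>

lemma absorb_dependent_square:
  assumes J: "finite J" "\<And>i. i \<in> J \<Longrightarrow> q i \<in> forms d"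
    and s: "s = (\<Sum>i\<in>J. const_poly (b i) * q i)"
  shows "sum_of_form_squares (card J) d (s\<^sup>2 + (\<Sum>i\<in>J. (q i)\<^sup>2))"
proof -
  define N where "N = (\<Sum>i\<in>J. (b i)\<^sup>2)"
  define t where "t = sqrt (1 + N)"
  \<comment> \<open>The positive solution of the quadratic equation, written without dividing by
    \<open>N\<close>, which may be zero.\<close>
  define \<beta> where "\<beta> = 1 / (1 + t)"
  have "N \<ge> 0" by (simp add: N_def sum_nonneg)
  then have t: "t \<ge> 0" "N = t\<^sup>2 - 1" by (simp_all add: t_def)
  then have "1 + t \<noteq> 0" by linarith
  then have \<beta>: "2 * \<beta> + \<beta>\<^sup>2 * N = 1"
    by (simp add: \<beta>_def t(2) divide_simps power2_eq_square) (simp add: algebra_simps)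
  define r where "r i = q i + const_poly (\<beta> * b i) * s" for i
  have s_forms: "s \<in> forms d" unfolding s using J(2) by (intro forms_sum const_poly_mult_forms)
  have r: "r i \<in> forms d" if "i \<in> J" for i
    unfolding r_def using J(2)[OF that] s_forms by (intro forms_add const_poly_mult_forms)
  have "(r i)\<^sup>2 = (q i)\<^sup>2 + const_poly (2 * \<beta>) * (s * (const_poly (b i) * q i))
      + const_poly (\<beta>\<^sup>2 * (b i)\<^sup>2) * s\<^sup>2" for i
    unfolding r_def power2_eq_square mult_2 const_poly_add const_poly_mult by (simp add: algebra_simps)
  then have "(\<Sum>i\<in>J. (r i)\<^sup>2) = (\<Sum>i\<in>J. (q i)\<^sup>2) + const_poly (2 * \<beta>) * (s * s) + const_poly (\<beta>\<^sup>2 * N) * s\<^sup>2"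
    by (simp only: sum.distrib sum_distrib_left[symmetric] sum_distrib_right[symmetric]
        const_poly_sum[symmetric] s[symmetric] N_def)
  also have "\<dots> = (\<Sum>i\<in>J. (q i)\<^sup>2) + (const_poly (2 * \<beta>) + const_poly (\<beta>\<^sup>2 * N)) * s\<^sup>2"
    by (simp only: power2_eq_square distrib_right add.assoc)
  also have "\<dots> = s\<^sup>2 + (\<Sum>i\<in>J. (q i)\<^sup>2)"
    by (simp only: const_poly_add[symmetric] \<beta>) simp
  finally show ?thesis using sum_of_form_squares_indexed[of J r, OF J(1) r] by simp
qed

text \<open>The relation expresses \<open>q j\<close> through the other forms, which then absorb its
  square.\<close>

lemma drop_dependent_square:
  assumes I: "finite I" "\<And>i. i \<in> I \<Longrightarrow> q i \<in> forms d"
    and dep: "(\<Sum>i\<in>I. const_poly (c i) * q i) = 0" and j: "j \<in> I" "c j \<noteq> 0"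
  shows "sum_of_form_squares (card I - 1) d (\<Sum>i\<in>I. (q i)\<^sup>2)"
proof -
  have "const_poly (c j) * q j + (\<Sum>i\<in>I - {j}. const_poly (c i) * q i) = 0"
    using dep sum.remove[OF I(1) j(1), of "\<lambda>i. const_poly (c i) * q i"] by simp
  then have *: "const_poly (c j) * q j = - (\<Sum>i\<in>I - {j}. const_poly (c i) * q i)"
    by (simp add: eq_neg_iff_add_eq_0)
  have "q j = const_poly (1 / c j) * (const_poly (c j) * q j)"
    using j(2) by (simp flip: mult.assoc const_poly_mult)
  also have "\<dots> = (\<Sum>i\<in>I - {j}. const_poly (- 1 / c j * c i) * q i)"
    unfolding * const_poly_mult by (simp add: sum_distrib_left sum_negf const_poly_uminus mult.assoc)
  finally have "sum_of_form_squares (card (I - {j})) d ((q j)\<^sup>2 + (\<Sum>i\<in>I - {j}. (q i)\<^sup>2))"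
    using I by (intro absorb_dependent_square) auto
  then show ?thesis using I(1) j(1) by (simp add: sum.remove)
qed

lemma sos_cone_iff: "p \<in> sos_cone d \<longleftrightarrow> (\<exists>k. sum_of_form_squares k d p)"
proof -
  have "p \<in> forms (2 * d)" if "sum_of_form_squares k d p" for k
  proof -
    obtain q where q: "\<forall>i<k. q i \<in> forms d" "p = (\<Sum>i<k. (q i)\<^sup>2)"
      using \<open>sum_of_form_squares k d p\<close> unfolding sum_of_form_squares_def by blast
    have "(q i)\<^sup>2 \<in> forms (2 * d)" if "i < k" for i
      using forms_mult[of "q i" d "q i" d] q(1) that by (simp add: power2_eq_square mult_2)
    then show ?thesis unfolding q(2) by (intro forms_sum) simp
  qed
  then show ?thesis by (auto simp: sos_cone_def)
qed

lemma sos_cone_square: "f \<in> forms d \<Longrightarrow> f * f \<in> sos_cone d"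
  unfolding sos_cone_iff using sum_of_form_squares_indexed[of "{()}" "\<lambda>_. f" d]
  by (intro exI[of _ 1]) (simp add: power2_eq_square)

lemma sos_cone_0: "0 \<in> sos_cone d"
  using sos_cone_square[OF forms_0] by simp

lemma sos_cone_add:
  assumes "p \<in> sos_cone d" "p' \<in> sos_cone d"
  shows "p + p' \<in> sos_cone d"
proof -
  obtain k :: nat and q where q: "\<forall>i<k. q i \<in> forms d" "p = (\<Sum>i<k. (q i)\<^sup>2)"
    using assms(1) unfolding sos_cone_iff sum_of_form_squares_def by blast
  obtain k' :: nat and q' where q': "\<forall>i<k'. q' i \<in> forms d" "p' = (\<Sum>i<k'. (q' i)\<^sup>2)"
    using assms(2) unfolding sos_cone_iff sum_of_form_squares_def by blast
  have "(\<Sum>i\<in>{..<k} <+> {..<k'}. (case_sum q q' i)\<^sup>2) = p + p'"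
    by (subst sum.Plus) (simp_all add: q q')
  moreover have "case_sum q q' i \<in> forms d" if "i \<in> {..<k} <+> {..<k'}" for i
    using that q q' by auto
  ultimately show ?thesis
    using sum_of_form_squares_indexed[of "{..<k} <+> {..<k'}" "case_sum q q'" d]
    unfolding sos_cone_iff by auto
qed

lemma sos_cone_const_mult:
  assumes "p \<in> sos_cone d" "0 \<le> c"
  shows "const_poly c * p \<in> sos_cone d"
proof -
  obtain k :: nat and q where q: "\<forall>i<k. q i \<in> forms d" "p = (\<Sum>i<k. (q i)\<^sup>2)"
    using assms(1) unfolding sos_cone_iff sum_of_form_squares_def by blast
  have "const_poly c = (const_poly (sqrt c) * const_poly (sqrt c) :: 'a real_mpoly)"
    using assms(2) by (simp flip: const_poly_mult)
  then have "const_poly c * p = (\<Sum>i<k. (const_poly (sqrt c) * q i)\<^sup>2)"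
    unfolding q(2) sum_distrib_left power_mult_distrib by (simp only: power2_eq_square)
  moreover have "sum_of_form_squares (card {..<k}) d (\<Sum>i<k. (const_poly (sqrt c) * q i)\<^sup>2)"
    using q(1) by (intro sum_of_form_squares_indexed const_poly_mult_forms) simp_all
  ultimately have "sum_of_form_squares (card {..<k}) d (const_poly c * p)" by (simp only:)
  then show ?thesis unfolding sos_cone_iff by blast
qed

subsection \<open>Supporting functionals\<close>

lemma mono_degree_split:
  assumes "mono_degree m = d + e"
  shows "\<exists>a b. m = a + b \<and> mono_degree a = d \<and> mono_degree b = e"
  using assms
proof (induction d arbitrary: m)
  case 0
  then show ?case by (intro exI[of _ 0] exI[of _ m]) simp
next
  case (Suc d)
  then obtain i m' where m: "m = Poly_Mapping.single i 1 + m'" "mono_degree m' = d + e"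
    using mono_degree_pos_split[of m "d + e"] by auto
  then obtain a b where "m' = a + b" "mono_degree a = d" "mono_degree b = e" using Suc.IH by blast
  with m show ?case
    by (intro exI[of _ "Poly_Mapping.single i 1 + a"] exI[of _ b]) (simp add: mono_degree_add add.assoc)
qed

text \<open>Full-dimensionality of the cone: a monomial of degree \<open>2 * d\<close> is a product
  of two monomials of degree \<open>d\<close>, and polarization writes a product as a combination of
  squares.\<close>

lemma span_coords_sos_cone:
  assumes "CARD('d::finite) = 2 * d"
  shows "span ((coords :: _ \<Rightarrow> real ^ ('n::finite, 'd) mono) ` sos_cone d) = UNIV"
proof -
  let ?c = "coords :: 'n real_mpoly \<Rightarrow> real ^ ('n, 'd) mono"
  have sq: "?c (h * h) \<in> span (?c ` sos_cone d)" if "h \<in> forms d" for h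
    by (rule span_base) (rule imageI, rule sos_cone_square[OF that])
  have prod: "?c (f * g) \<in> span (?c ` sos_cone d)" if fg: "f \<in> forms d" "g \<in> forms d" for f g
  proof -
    have half: "const_poly (1 / 2) + const_poly (1 / 2) = (1 :: 'n real_mpoly)"
      unfolding const_poly_add[symmetric] by simp
    have "const_poly (1 / 2) * ((f + g) * (f + g)) + const_poly (- (1 / 2)) * (f * f)
        + const_poly (- (1 / 2)) * (g * g) = (const_poly (1 / 2) + const_poly (1 / 2)) * (f * g)"
      by (simp only: const_poly_uminus) (simp add: algebra_simps)
    then have "?c (f * g) = ?c (const_poly (1 / 2) * ((f + g) * (f + g)) + const_poly (- (1 / 2)) * (f * f)
        + const_poly (- (1 / 2)) * (g * g))"
      by (simp only: half mult_1_left)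
    also have "\<dots> = (1 / 2) *\<^sub>R ?c ((f + g) * (f + g)) + (- (1 / 2)) *\<^sub>R ?c (f * f) + (- (1 / 2)) *\<^sub>R ?c (g * g)"
      by (simp only: coords_add coords_const_mult)
    finally show ?thesis
      using span_add[OF span_add[OF span_scale[OF sq[OF forms_add[OF fg]]] span_scale[OF sq[OF fg(1)]]]
          span_scale[OF sq[OF fg(2)]]] by (simp only:)
  qed
  have "axis k 1 \<in> span (?c ` sos_cone d)" for k
  proof -
    have "mono_degree (Rep_mono k) = d + d" using Rep_mono[of k] assms by simp
    from mono_degree_split[OF this] obtain a b
      where ab: "Rep_mono k = a + b" "mono_degree a = d" "mono_degree b = d" by blast
    have "axis k 1 = ?c (Poly_Mapping.single (Rep_mono k) 1)"
      by (simp add: vec_eq_iff coords_def axis_def lookup_single when_def Rep_mono_inject eq_commute[of k])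
    also have "Poly_Mapping.single (Rep_mono k) 1 = Poly_Mapping.single a 1 * (Poly_Mapping.single b 1 :: 'n real_mpoly)"
      by (simp add: ab(1) mult_single)
    finally show ?thesis using prod[OF forms_single[OF ab(2)] forms_single[OF ab(3)]] by (simp only:)
  qed
  then have in_span: "(\<Sum>k\<in>UNIV. v $ k *\<^sub>R axis k 1) \<in> span (?c ` sos_cone d)" for v :: "real ^ ('n, 'd) mono"
    by (intro span_sum span_scale)
  show ?thesis
  proof (rule UNIV_eq_I[symmetric])
    fix v :: "real ^ ('n, 'd) mono"
    have "(\<Sum>k\<in>UNIV. v $ k *\<^sub>R axis k 1) = v"
      by (rule basis_expansion[of v, unfolded scalar_mult_eq_scaleR])
    then show "v \<in> span (?c ` sos_cone d)" using in_span[of v] by (simp only:)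
  qed
qed

text \<open>\<open>coords\<close> is \<open>Poly_Mapping.lookup\<close> followed by a continuous map
  that reads off finitely many values. This carries open sets of coordinate vectors over to
  \<open>forms_topology\<close>.\<close>

lemma openin_forms_topology:
  assumes "open T" and d: "d = CARD('d::finite)"
  shows "openin (forms_topology d) {r \<in> forms d. (coords r :: real ^ ('n::finite, 'd) mono) \<in> T}"
proof -
  define E :: "(('n \<Rightarrow>\<^sub>0 nat) \<Rightarrow> real) \<Rightarrow> real ^ ('n, 'd) mono" where "E \<phi> = (\<chi> m. \<phi> (Rep_mono m))" for \<phi>
  have "continuous_on UNIV E"
    unfolding E_def by (intro continuous_on_vec_lambda continuous_on_product_coordinates)
  then have "open (E -` T)" using assms(1) by (rule open_vimage[rotated])
  moreover have "{r \<in> forms d. (coords r :: real ^ ('n, 'd) mono) \<in> T} = Poly_Mapping.lookup -` (E -` T) \<inter> forms d"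
    by (auto simp: coords_def E_def)
  ultimately show ?thesis
    unfolding forms_topology_def openin_pullback_topology by (metis open_openin)
qed

text \<open>\<open>L\<close> is the normal of a supporting hyperplane of the cone at
  \<open>p\<close>, taken in coordinates.\<close>

lemma frontier_sos_cone_functional:
  fixes p :: "'n::finite real_mpoly"
  assumes d: "CARD('d::finite) = 2 * d" and p: "p \<in> sos_cone d"
    and frontier: "p \<in> forms_topology (2 * d) frontier_of sos_cone d"
  obtains L where "psd_functional L d" "L p = 0" "\<exists>f\<in>forms d. L (f * f) \<noteq> 0"
proof -
  let ?c = "coords :: 'n real_mpoly \<Rightarrow> real ^ ('n, 'd) mono"
  define C where "C = ?c ` sos_cone d"
  have "convex C"
    unfolding C_def convex_def
    by (auto simp flip: coords_const_mult coords_add intro!: imageI sos_cone_add sos_cone_const_mult)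
  have "?c 0 = 0" by (simp add: coords_def vec_eq_iff)
  then have "0 \<in> C" unfolding C_def using sos_cone_0 by (metis imageI)
  then have hull: "affine hull C = UNIV"
    using affine_hull_span_0[of C] hull_inc[of 0 C] span_coords_sos_cone[OF d, where 'n = 'n]
    by (simp add: C_def)
  \<comment> \<open>As the affine hull is the whole space, the relative interior is the interior,
    and an interior point in coordinates would be interior in \<open>forms_topology\<close>.\<close>
  have "?c p \<notin> rel_interior C"
  proof
    assume "?c p \<in> rel_interior C"
    then obtain T where T: "open T" "?c p \<in> T" "T \<subseteq> C"
      unfolding mem_rel_interior hull by auto
    let ?U = "{r \<in> forms (2 * d). ?c r \<in> T}"
    have "?U \<subseteq> sos_cone d"
    proof
      fix r assume r: "r \<in> ?U"
      with T(3) obtain s where s: "s \<in> sos_cone d" "?c r = ?c s" by (auto simp: C_def)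
      have "r = form_of (?c r)" "s = form_of (?c s)"
        using r s(1) d by (simp_all add: form_of_coords sos_cone_def)
      with s show "r \<in> sos_cone d" by simp
    qed
    moreover have "openin (forms_topology (2 * d)) ?U"
      by (rule openin_forms_topology[OF T(1)]) (simp add: d)
    moreover have "p \<in> ?U" using p T(2) by (simp add: sos_cone_def)
    ultimately have "p \<in> forms_topology (2 * d) interior_of sos_cone d"
      unfolding interior_of_def by blast
    with frontier show False by (simp add: frontier_of_def)
  qed
  moreover have "?c p \<in> C" using p by (simp add: C_def)
  ultimately obtain a where a: "\<And>y. y \<in> C \<Longrightarrow> a \<bullet> ?c p \<le> a \<bullet> y"
    "\<And>y. y \<in> rel_interior C \<Longrightarrow> a \<bullet> ?c p < a \<bullet> y"
    using supporting_hyperplane_rel_boundary[OF \<open>convex C\<close>] by metis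
  define L where "L r = a \<bullet> ?c r" for r
  have lin: "poly_linear L"
    by (simp add: poly_linear_def L_def coords_add coords_const_mult inner_add_right)
  have ge: "L p \<le> L s" if "s \<in> sos_cone d" for s
    using a(1) that by (simp add: L_def C_def)
  \<comment> \<open>Comparing \<open>p\<close> with \<open>0\<close> and \<open>2 p\<close>, which
    both lie in the cone, gives \<open>L p = 0\<close>.\<close>
  have "L p \<le> 0" using ge[OF sos_cone_0] poly_linear_0[OF lin] by simp
  moreover have "L p \<le> 2 * L p"
    using ge[OF sos_cone_const_mult[OF p, of 2]] by (simp add: poly_linear_const_mult[OF lin])
  ultimately have Lp: "L p = 0" by simp
  \<comment> \<open>The strict inequality on the relative interior rules out that \<open>L\<close>
    vanishes on all squares.\<close>
  have "rel_interior C \<noteq> {}" using \<open>convex C\<close> \<open>0 \<in> C\<close> rel_interior_eq_empty by blast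
  then obtain y where "y \<in> rel_interior C" by blast
  moreover from this obtain s where "s \<in> sos_cone d" "y = ?c s"
    using rel_interior_subset[of C] unfolding C_def by blast
  ultimately have s: "s \<in> sos_cone d" "L s > 0"
    using a(2)[of y] Lp by (simp_all add: L_def)
  then obtain k :: nat and q where q: "\<forall>i<k. q i \<in> forms d" "s = (\<Sum>i<k. (q i)\<^sup>2)"
    unfolding sos_cone_iff sum_of_form_squares_def by blast
  have "\<exists>f\<in>forms d. L (f * f) \<noteq> 0"
  proof (rule ccontr)
    assume "\<not> ?thesis"
    then have "L s = 0"
      unfolding q(2) poly_linear_sum[OF lin] power2_eq_square using q(1) by (intro sum.neutral) auto
    with s show False by simp
  qed
  moreover have "psd_functional L d"
    using lin ge[OF sos_cone_square] Lp by (simp add: psd_functional_def)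
  ultimately show ?thesis by (intro that[of L] Lp)
qed

section \<open>The number of squares\<close>

lemma mpoly_eval_sum_squares_eq_0:
  assumes "\<And>i. i \<in> I \<Longrightarrow> mpoly_eval (q i) x = 0"
  shows "mpoly_eval (\<Sum>i\<in>I. (q i)\<^sup>2) x = 0"
  unfolding mpoly_eval_sum mpoly_eval_power2 using assms by (intro sum.neutral) simp

lemma two_squares_of_ternary_cubics_zero:
  fixes p :: "3 real_mpoly"
  assumes "sum_of_form_squares 2 3 p"
  shows "\<exists>x. x \<noteq> 0 \<and> mpoly_eval p x = 0"
proof -
  obtain q :: "nat \<Rightarrow> 3 real_mpoly" where q: "\<forall>i<2. q i \<in> forms 3" "p = (\<Sum>i<2. (q i)\<^sup>2)"
    using assms by (rule sum_of_form_squaresE)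
  have "q 0 \<in> forms 3" "q 1 \<in> forms 3"
    by (rule q(1)[rule_format], simp)+
  then obtain x where x: "x \<noteq> 0" "mpoly_eval (q 0) x = 0" "mpoly_eval (q 1) x = 0"
    using ternary_cubics_common_zero by blast
  have "mpoly_eval p x = 0"
    unfolding q(2)
  proof (rule mpoly_eval_sum_squares_eq_0)
    fix i :: nat assume "i \<in> {..<2}"
    then have "i = 0 \<or> i = 1" by auto
    then show "mpoly_eval (q i) x = 0" using x(2,3) by blast
  qed
  with x(1) show ?thesis by blast
qed

theorem corollary1p3:
  fixes p :: "3 real_mpoly"
  assumes "p \<in> sos_cone 3"
    and "p \<in> (forms_topology 6) frontier_of (sos_cone 3)"
    and "\<forall>x :: real ^ 3. x \<noteq> 0 \<longrightarrow> mpoly_eval p x > 0"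
  shows "sum_of_form_squares 3 3 p \<and> \<not> sum_of_form_squares 2 3 p"
proof
  have pos: "mpoly_eval p x \<noteq> 0" if "x \<noteq> 0" for x
    using assms(3)[rule_format, OF that] by simp
  show "\<not> sum_of_form_squares 2 3 p"
    using two_squares_of_ternary_cubics_zero pos by blast
  have ex: "\<exists>k. sum_of_form_squares k 3 p" using assms(1) sos_cone_iff by blast
  \<comment> \<open>In a shortest representation the forms are linearly independent, since a
    relation would save a square.\<close>
  define k where "k = (LEAST k. sum_of_form_squares k 3 p)"
  have k: "sum_of_form_squares k 3 p" unfolding k_def by (rule LeastI_ex[OF ex])
  have k_min: "k \<le> m" if "sum_of_form_squares m 3 p" for m
    unfolding k_def using that by (rule Least_le)
  have "k \<le> 3"
  proof (rule ccontr)
    assume "\<not> k \<le> 3"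
    then have k4: "4 \<le> k" by simp
    obtain q where q_all: "\<forall>i<k. q i \<in> forms 3" and p_eq: "p = (\<Sum>i<k. (q i)\<^sup>2)"
      using k by (rule sum_of_form_squaresE)
    note q = q_all[rule_format] p_eq
    \<comment> \<open>The index type \<open>6\<close> supplies the degree of \<open>p\<close> for
      the coordinates.\<close>
    have "CARD(6) = 2 * 3" "p \<in> forms_topology (2 * 3) frontier_of sos_cone 3" using assms(2) by simp_all
    then obtain L where L: "psd_functional L 3" "L p = 0" "\<exists>f\<in>forms 3. L (f * f) \<noteq> 0"
      using frontier_sos_cone_functional[where 'd = 6, of 3 p] assms(1) by blast
    interpret psd_functional_cubics L using L(1) by (simp add: psd_functional_cubics_def)
    \<comment> \<open>A vanishing sum of nonnegative terms: every cubic of the representation is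
      null.\<close>
    have "(\<Sum>i<k. L (q i * q i)) = 0"
      using L(2) by (simp add: q(2) poly_linear_sum[OF lin] power2_eq_square)
    then have "L (q i * q i) = 0" if "i < k" for i
      using that psd[OF q(1)] by (subst (asm) sum_nonneg_eq_0_iff) auto
    then have null: "q i \<in> null_forms" if "i < k" for i
      using that q(1) by (simp add: null_forms_iff)
    \<comment> \<open>Only the first four cubics are kept, indexed by the type
      \<open>4\<close>.\<close>
    obtain e :: "4 \<Rightarrow> nat" where e: "bij_betw e UNIV {..<4}"
      using finite_same_card_bij[of "UNIV :: 4 set" "{..<4 :: nat}"] by auto
    have e_less: "e i < k" for i
    proof -
      have "e i \<in> {..<4}" using bij_betwE[OF e] by blast
      with k4 show ?thesis by simp
    qed
    have inj: "inj e" using e by (simp add: bij_betw_def)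
    have indep: "c = 0" if dep: "(\<Sum>i\<in>UNIV. const_poly (c $ i) * q (e i)) = 0" for c
    proof (rule ccontr)
      assume "c \<noteq> 0"
      then obtain i where i: "c $ i \<noteq> 0" by (auto simp: vec_eq_iff)
      \<comment> \<open>The relation among the four cubics, extended by zero to all \<open>k\<close>
        of them.\<close>
      define b where "b n = (if n \<in> range e then c $ (inv e n) else 0)" for n
      have be: "b (e j) = c $ j" for j by (simp add: b_def inj)
      have "(\<Sum>n<k. const_poly (b n) * q n) = (\<Sum>n\<in>range e. const_poly (b n) * q n)"
        using e_less by (intro sum.mono_neutral_right) (auto simp: b_def)
      also have "\<dots> = 0" using dep by (simp add: sum.reindex[OF inj] be)
      finally have "sum_of_form_squares (card {..<k} - 1) 3 (\<Sum>n<k. (q n)\<^sup>2)"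
        using e_less[of i] i q(1) by (intro drop_dependent_square[where c = b and j = "e i"]) (auto simp: be)
      then have "sum_of_form_squares (k - 1) 3 p" by (simp add: q(2))
      with k_min[of "k - 1"] k4 show False by simp
    qed
    have "\<not> forms 3 \<subseteq> null_forms" using L(3) null_forms_iff by blast
    then have "\<exists>x. x \<noteq> 0 \<and> (\<forall>f\<in>null_forms. mpoly_eval f x = 0)"
    proof (rule common_zero_if_corank_4[where q = "\<lambda>i. q (e i)", rotated 2])
      show "q (e i) \<in> null_forms" for i by (rule null[OF e_less])
    qed (rule indep)
    then obtain x where x: "x \<noteq> 0" "\<forall>f\<in>null_forms. mpoly_eval f x = 0" by blast
    \<comment> \<open>All squares vanish at a common zero of the null cubics, contrary to strict
      positivity.\<close>
    have "mpoly_eval p x = 0"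
      unfolding q(2) using x(2) null by (intro mpoly_eval_sum_squares_eq_0) blast
    with pos[OF x(1)] show False by blast
  qed
  \<comment> \<open>From \<open>k \<le> 3\<close>, the representation is filled up with zero
    forms.\<close>
  with k show "sum_of_form_squares 3 3 p" by (rule sum_of_form_squares_mono)
qed

end
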